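(* Let $k$ be an algebraically closed field of characteristic zero. For every integer $r$ with $6\le r\le 15$, the translated one-step locus $$V_{5,r}\subset \operatorname{Hilb}^{6+r}(\mathbb A^5_k)$$ is contained in the smoothable component $\mathcal R^5_{6+r}$ of $\operatorname{Hilb}^{6+r}(\mathbb A^5_k)$.
   Context: Let $S=k[x_1,\ldots,x_5]$ with $\mathfrak m=(x_1,\ldots,x_5)$, and let $S_2$ be the space of quadratic forms, so $\dim_k S_2=15$. For $1\le r\le 15$ and a codimension-$r$ linear subspace $Q\subset S_2$, put $I_Q=(Q)+\mathfrak m^3$. Then $S/I_Q$ is a local algebra with Hilbert function $(1,5,r)$ and length $6+r$, so $I_Q$ defines a point of the Hilbert scheme $\operatorname{Hilb}^{6+r}(\mathbb A^5)$ of length-$(6+r)$ subschemes of $\mathbb A^5$. The translated one-step locus $V_{5,r}\subset \operatorname{Hilb}^{6+r}(\mathbb A^5)$ is the closure of the set of all translates, under the translation action of $\mathbb A^5$ on itself, of the points $[S/I_Q]$, where $Q$ ranges over all codimension-$r$ subspaces of $S_2$. The smoothable component $\mathcal R^5_d\subset\operatorname{Hilb}^d(\mathbb A^5)$ is the closure of the locus parametrizing $d$ distinct reduced points. Containment is containment of closed subsets. *)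

theory Defs
  imports
    "HOL-Analysis.Abstract_Topology"
    "HOL-Library.Poly_Mapping"
    "HOL-Library.Numeral_Type"
    "HOL-Computational_Algebra.Polynomial"
begin

section \<open>Multivariate polynomials\<close>

text \<open>
  \<open>('v, 'k) mpoly\<close> is the polynomial ring with variables indexed by the type \<open>'v\<close>: a finitely
  supported map from exponent vectors to coefficients, with the convolution product provided by
  \<^theory>\<open>HOL-Library.Poly_Mapping\<close>.
\<close>

type_synonym ('v, 'k) mpoly = "('v \<Rightarrow>\<^sub>0 nat) \<Rightarrow>\<^sub>0 'k"

definition Const :: "'k::zero \<Rightarrow> ('v, 'k) mpoly"
  where "Const c = Poly_Mapping.single 0 c"

definition monomial :: "('v \<Rightarrow>\<^sub>0 nat) \<Rightarrow> ('v, 'k::zero_neq_one) mpoly"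
  where "monomial m = Poly_Mapping.single m 1"

definition Var :: "'v \<Rightarrow> ('v, 'k::zero_neq_one) mpoly"
  where "Var i = monomial (Poly_Mapping.single i 1)"

definition scale :: "'k::comm_ring_1 \<Rightarrow> ('v, 'k) mpoly \<Rightarrow> ('v, 'k) mpoly"
  where "scale c p = Const c * p"

text \<open>
  Applying \<open>h\<close> to the coefficients and substituting \<open>x v\<close> for the variable \<open>v\<close>.
\<close>

definition subst :: "('k::zero \<Rightarrow> 'b::comm_semiring_1) \<Rightarrow> ('v \<Rightarrow> 'b) \<Rightarrow> ('v, 'k) mpoly \<Rightarrow> 'b"
  where "subst h x p =
    (\<Sum>m\<in>Poly_Mapping.keys p.
       h (Poly_Mapping.lookup p m) *
       (\<Prod>v\<in>Poly_Mapping.keys m. x v ^ Poly_Mapping.lookup m v))"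

abbreviation eval :: "('v \<Rightarrow> 'k::comm_semiring_1) \<Rightarrow> ('v, 'k) mpoly \<Rightarrow> 'k"
  where "eval \<equiv> subst (\<lambda>c. c)"

text \<open>
  Ideals of a commutative ring are its submodules as a module over itself, so
  \<open>poly_ideal.subspace I\<close> says that \<open>I\<close> is an ideal and \<open>poly_ideal.span A\<close> is the ideal
  generated by \<open>A\<close>.  The notions \<open>poly_vs.subspace\<close>, \<open>poly_vs.dim\<close> are those of vector spaces over
  the field of coefficients.
\<close>

global_interpretation poly_ideal: module "(*) :: 'a \<Rightarrow> 'a \<Rightarrow> 'a::comm_ring_1"
  by standard (simp_all add: algebra_simps)

global_interpretation poly_vs:
  vector_space "scale :: 'k \<Rightarrow> ('v, 'k::field) mpoly \<Rightarrow> ('v, 'k) mpoly"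
proof
  fix a b :: 'k and p q :: "('v, 'k) mpoly"
  show "scale a (p + q) = scale a p + scale a q"
    unfolding scale_def by (rule distrib_left)
  show "scale (a + b) p = scale a p + scale b p"
    unfolding scale_def Const_def single_add by (rule distrib_right)
  show "scale a (scale b p) = scale (a * b) p"
    unfolding scale_def Const_def mult.assoc[symmetric] mult_single by simp
  show "scale 1 p = p"
    unfolding scale_def Const_def single_one by simp
qed

section \<open>The Hilbert scheme of points of affine space\<close>

text \<open>
  \<open>is_basis_mod I B\<close>: the classes of the elements of \<open>B\<close> form a finite basis, without
  repetitions, of the quotient space of the polynomial ring by \<open>I\<close>.
\<close>

definition is_expansion_mod ::
  "('v, 'k::field) mpoly set \<Rightarrow> ('v, 'k) mpoly set \<Rightarrow> ('v, 'k) mpoly \<Rightarrow> (('v, 'k) mpoly \<Rightarrow> 'k) \<Rightarrow> bool"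
  where "is_expansion_mod I B p c \<longleftrightarrow>
    (\<forall>b. b \<notin> B \<longrightarrow> c b = 0) \<and> p - (\<Sum>b\<in>B. scale (c b) b) \<in> I"

definition is_basis_mod :: "('v, 'k::field) mpoly set \<Rightarrow> ('v, 'k) mpoly set \<Rightarrow> bool"
  where "is_basis_mod I B \<longleftrightarrow> finite B \<and> (\<forall>p. \<exists>!c. is_expansion_mod I B p c)"

definition coeff_mod ::
  "('v, 'k::field) mpoly set \<Rightarrow> ('v, 'k) mpoly set \<Rightarrow> ('v, 'k) mpoly \<Rightarrow> ('v, 'k) mpoly \<Rightarrow> 'k"
  where "coeff_mod I B p = (THE c. is_expansion_mod I B p c)"

text \<open>
  The closed points of the Hilbert scheme of length \<open>d\<close> subschemes of affine space over an
  algebraically closed field: the ideals of colength \<open>d\<close>.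
\<close>

definition hilb :: "nat \<Rightarrow> ('n::finite, 'k::field) mpoly set set"
  where "hilb d = {I. poly_ideal.subspace I \<and> (\<exists>B. card B = d \<and> is_basis_mod I B)}"

text \<open>
  For a set \<open>M\<close> of \<open>d\<close> exponent vectors, the locus where the monomials with exponents in \<open>M\<close> are a
  basis of the quotient is the standard affine open chart of the Hilbert scheme.  Its coordinate
  ring is generated by the coefficients \<open>chart_coord M I (m, b)\<close>, \<open>b \<in> M\<close>, of the expansions
  \<open>x\<^sup>m \<equiv> (\<Sum>b\<in>M. chart_coord M I (m, b) x\<^sup>b) (mod I)\<close>.  The Zariski topology is therefore generated
  by the principal open subsets of these charts, each given by a polynomial \<open>F\<close> in the coordinates.
\<close>

definition hilb_chart :: "('n::finite \<Rightarrow>\<^sub>0 nat) set \<Rightarrow> ('n, 'k::field) mpoly set set"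
  where "hilb_chart M = {I \<in> hilb (card M). is_basis_mod I (monomial ` M)}"

definition chart_coord ::
  "('n::finite \<Rightarrow>\<^sub>0 nat) set \<Rightarrow> ('n, 'k::field) mpoly set \<Rightarrow> ('n \<Rightarrow>\<^sub>0 nat) \<times> ('n \<Rightarrow>\<^sub>0 nat) \<Rightarrow> 'k"
  where "chart_coord M I = (\<lambda>(m, b). coeff_mod I (monomial ` M) (monomial m) (monomial b))"

definition principal_open ::
  "('n::finite \<Rightarrow>\<^sub>0 nat) set \<Rightarrow> (('n \<Rightarrow>\<^sub>0 nat) \<times> ('n \<Rightarrow>\<^sub>0 nat), 'k::field) mpoly
    \<Rightarrow> ('n, 'k) mpoly set set"
  where "principal_open M F = {I \<in> hilb_chart M. eval (chart_coord M I) F \<noteq> 0}"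

definition hilb_topology :: "nat \<Rightarrow> ('n::finite, 'k::field) mpoly set topology"
  where "hilb_topology d =
    topology_generated_by {principal_open M F | M F. finite M \<and> card M = d}"

text \<open>
  The monomial charts cover the Hilbert scheme, so the topology above lives on all of \<open>hilb d\<close>.
\<close>

lemma poly_eq_sum_monomials:
  "(p :: ('v, 'k::field) mpoly) =
     (\<Sum>m\<in>Poly_Mapping.keys p. scale (Poly_Mapping.lookup p m) (monomial m))"
proof -
  have "scale c (monomial m) = Poly_Mapping.single m c" for c :: 'k and m :: "'v \<Rightarrow>\<^sub>0 nat"
    by (simp add: scale_def Const_def monomial_def mult_single)
  then show ?thesis
    by (intro poly_mapping_eqI)
      (auto simp: lookup_sum lookup_single when_def in_keys_iff sum.delta)
qed

lemma ideal_scale: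
  "poly_ideal.subspace I \<Longrightarrow> p \<in> I \<Longrightarrow> scale c p \<in> I" for p :: "('v, 'k::field) mpoly"
  unfolding scale_def by (rule poly_ideal.subspace_scale)

lemma monomial_basis_mod:
  fixes I :: "('v, 'k::field) mpoly set"
  assumes I: "poly_ideal.subspace I" and B: "is_basis_mod I B"
  obtains M where "finite M" "card M = card B" "is_basis_mod I (monomial ` M)"
proof -
  define \<pi> where "\<pi> p = (\<Sum>b\<in>B. scale (coeff_mod I B p b) b)" for p
  have finB: "finite B" and ex1: "\<And>p. \<exists>!c. is_expansion_mod I B p c"
    using B by (auto simp: is_basis_mod_def)
  have ce: "is_expansion_mod I B p (coeff_mod I B p)" for p
    unfolding coeff_mod_def by (rule theI'[OF ex1])
  have ceq: "coeff_mod I B p = c" if "is_expansion_mod I B p c" for p c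
    using ex1 ce that by blast
  have \<pi>I: "p - \<pi> p \<in> I" for p
    using ce[of p] by (simp add: is_expansion_mod_def \<pi>_def)
  have add: "\<pi> (p + q) = \<pi> p + \<pi> q" for p q
  proof -
    have "p + q - (\<Sum>b\<in>B. scale (coeff_mod I B p b + coeff_mod I B q b) b)
        = (p - \<pi> p) + (q - \<pi> q)"
      by (simp add: \<pi>_def poly_vs.scale_left_distrib sum.distrib)
    also have "\<dots> \<in> I" by (intro poly_ideal.subspace_add[OF I] \<pi>I)
    finally have "is_expansion_mod I B (p + q) (\<lambda>b. coeff_mod I B p b + coeff_mod I B q b)"
      using ce[of p] ce[of q] by (simp add: is_expansion_mod_def)
    from ceq[OF this] show ?thesis
      by (simp add: \<pi>_def poly_vs.scale_left_distrib sum.distrib)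
  qed
  have sc: "\<pi> (scale a p) = scale a (\<pi> p)" for a p
  proof -
    have "scale a p - (\<Sum>b\<in>B. scale (a * coeff_mod I B p b) b) = scale a (p - \<pi> p)"
      by (simp add: \<pi>_def poly_vs.scale_right_diff_distrib poly_vs.scale_sum_right)
    also have "\<dots> \<in> I" by (intro ideal_scale[OF I] \<pi>I)
    finally have "is_expansion_mod I B (scale a p) (\<lambda>b. a * coeff_mod I B p b)"
      using ce[of p] by (simp add: is_expansion_mod_def)
    from ceq[OF this] show ?thesis
      by (simp add: \<pi>_def poly_vs.scale_sum_right)
  qed
  have zero: "\<pi> p = 0" if "p \<in> I" for p
  proof -
    have "is_expansion_mod I B p (\<lambda>_. 0)" using that by (simp add: is_expansion_mod_def)
    from ceq[OF this] show ?thesis by (simp add: \<pi>_def)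
  qed
  have sum: "\<pi> (\<Sum>x\<in>A. scale (g x) (f x)) = (\<Sum>x\<in>A. scale (g x) (\<pi> (f x)))"
    if "finite A" for A :: "'z set" and f g
    using that by induction (simp_all add: add sc zero poly_ideal.subspace_0[OF I])
  have idB: "\<pi> b = b" if "b \<in> B" for b
  proof -
    have "(\<Sum>x\<in>B. scale (if x = b then 1 else 0) x) = (\<Sum>x\<in>B. if x = b then b else 0)"
      by (rule sum.cong) auto
    then have s: "(\<Sum>x\<in>B. scale (if x = b then 1 else 0) x) = b"
      using finB that by simp
    then have "is_expansion_mod I B b (\<lambda>x. if x = b then 1 else 0)"
      using that poly_ideal.subspace_0[OF I] by (simp add: is_expansion_mod_def)
    from ceq[OF this] s show ?thesis by (simp add: \<pi>_def)
  qed
  have indB: "poly_vs.independent B"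
  proof (rule poly_vs.independent_if_scalars_zero[OF finB])
    fix f x assume f: "(\<Sum>x\<in>B. scale (f x) x) = 0" and x: "x \<in> B"
    have "(\<Sum>x\<in>B. scale (if x \<in> B then f x else 0) x) = 0" using f by simp
    then have "is_expansion_mod I B 0 (\<lambda>x. if x \<in> B then f x else 0)"
      using poly_ideal.subspace_0[OF I] by (simp add: is_expansion_mod_def)
    moreover have "is_expansion_mod I B 0 (\<lambda>_. 0)"
      using poly_ideal.subspace_0[OF I] by (simp add: is_expansion_mod_def)
    ultimately have "(\<lambda>x. if x \<in> B then f x else 0) = (\<lambda>_. 0)" using ex1 by blast
    from fun_cong[OF this, of x] x show "f x = 0" by simp
  qed
  define A where "A = Set.range (\<lambda>m. \<pi> (monomial m))"
  have inA: "\<pi> p \<in> poly_vs.span A" for p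
  proof -
    have "\<pi> p = (\<Sum>m\<in>Poly_Mapping.keys p. scale (Poly_Mapping.lookup p m) (\<pi> (monomial m)))"
      by (subst poly_eq_sum_monomials) (rule sum, simp)
    also have "\<dots> \<in> poly_vs.span A"
      by (intro poly_vs.span_sum poly_vs.span_scale poly_vs.span_base) (auto simp: A_def)
    finally show ?thesis .
  qed
  have spanAB: "poly_vs.span A = poly_vs.span B"
  proof
    have "A \<subseteq> poly_vs.span B"
      unfolding A_def \<pi>_def by (blast intro: poly_vs.span_sum poly_vs.span_scale poly_vs.span_base)
    then show "poly_vs.span A \<subseteq> poly_vs.span B" by (simp add: poly_vs.span_minimal)
    have "B \<subseteq> poly_vs.span A" using inA idB by (metis subsetI)
    then show "poly_vs.span B \<subseteq> poly_vs.span A" by (simp add: poly_vs.span_minimal)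
  qed
  obtain C where C: "C \<subseteq> A" "poly_vs.independent C" "A \<subseteq> poly_vs.span C" "card C = poly_vs.dim A"
    using poly_vs.basis_exists by blast
  have spanC: "poly_vs.span C = poly_vs.span B"
    using C spanAB by (metis poly_vs.span_mono poly_vs.span_minimal poly_vs.subspace_span subset_antisym)
  have finC: "finite C"
    using poly_vs.independent_span_bound[OF finB C(2)] spanC poly_vs.span_superset by blast
  have cardC: "card C = card B"
    using poly_vs.dim_eq_card[OF spanC C(2)] poly_vs.dim_eq_card_independent[OF indB]
    by (metis C(2) indB poly_vs.dim_eq_card_independent poly_vs.dim_span spanC)
  obtain M where M: "C = (\<lambda>m. \<pi> (monomial m)) ` M" "inj_on (\<lambda>m. \<pi> (monomial m)) M"
    using C(1) unfolding A_def by (metis subset_image_inj)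
  have finM: "finite M" using M finC by (simp add: finite_image_iff)
  have cardM: "card M = card B" using M cardC by (simp add: card_image)
  have inj: "inj_on (monomial :: _ \<Rightarrow> ('v, 'k) mpoly) M" using M(2) by (auto simp: inj_on_def)
  have "\<exists>!c. is_expansion_mod I (monomial ` M) p c" for p
  proof (rule ex_ex1I)
    have "\<pi> p \<in> poly_vs.span C" using inA[of p] spanAB spanC by simp
    then obtain r where r: "\<pi> p = (\<Sum>x\<in>C. scale (r x) x)"
      using poly_vs.span_finite[OF finC] by auto
    define c where "c b = (if b \<in> monomial ` M then r (\<pi> b) else 0)" for b
    have "p - (\<Sum>b\<in>monomial ` M. scale (c b) b)
        = (p - \<pi> p) - (\<Sum>m\<in>M. scale (r (\<pi> (monomial m))) (monomial m - \<pi> (monomial m)))"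
      unfolding r M(1) sum.reindex[OF M(2)] sum.reindex[OF inj] o_def
      by (simp add: c_def poly_vs.scale_right_diff_distrib sum_subtractf)
    also have "\<dots> \<in> I"
      by (intro poly_ideal.subspace_diff[OF I] \<pi>I poly_ideal.subspace_sum[OF I] ideal_scale[OF I])
    finally show "\<exists>c. is_expansion_mod I (monomial ` M) p c"
      by (intro exI[of _ c]) (auto simp: is_expansion_mod_def c_def)
  next
    fix c d assume c: "is_expansion_mod I (monomial ` M) p c" and d: "is_expansion_mod I (monomial ` M) p d"
    have eq: "\<pi> p = (\<Sum>m\<in>M. scale (e (monomial m)) (\<pi> (monomial m)))"
      if e: "is_expansion_mod I (monomial ` M) p e" for e
    proof -
      let ?s = "\<Sum>b\<in>monomial ` M. scale (e b) b"
      have "\<pi> p = \<pi> (p - ?s) + \<pi> ?s" by (simp flip: add)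
      also have "\<dots> = \<pi> ?s" using e by (simp add: is_expansion_mod_def zero)
      also have "\<dots> = (\<Sum>m\<in>M. scale (e (monomial m)) (\<pi> (monomial m)))"
        unfolding sum.reindex[OF inj] o_def by (rule sum[OF finM])
      finally show ?thesis .
    qed
    have z: "c (monomial m) = d (monomial m)" if m: "m \<in> M" for m
    proof -
      define u where "u x = (let m = the_inv_into M (\<lambda>m. \<pi> (monomial m)) x in c (monomial m) - d (monomial m))" for x
      have u: "u (\<pi> (monomial m)) = c (monomial m) - d (monomial m)" if "m \<in> M" for m
        using the_inv_into_f_f[OF M(2) that] by (simp add: u_def)
      have "(\<Sum>x\<in>C. scale (u x) x) = (\<Sum>m\<in>M. scale (c (monomial m) - d (monomial m)) (\<pi> (monomial m)))"
        unfolding M(1) sum.reindex[OF M(2)] o_def by (rule sum.cong) (simp_all add: u)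
      also have "\<dots> = 0"
        using eq[OF c] eq[OF d] by (simp add: poly_vs.scale_left_diff_distrib sum_subtractf)
      finally have "u (\<pi> (monomial m)) = 0"
        using poly_vs.independentD[OF C(2) finC order.refl] M(1) m by blast
      then show ?thesis using u[OF m] by simp
    qed
    show "c = d"
    proof
      fix b show "c b = d b"
        by (cases "b \<in> monomial ` M") (use c d z in \<open>auto simp: is_expansion_mod_def\<close>)
    qed
  qed
  then have "is_basis_mod I (monomial ` M)" using finM by (simp add: is_basis_mod_def)
  with finM cardM show thesis by (rule that)
qed

lemma topspace_hilb_topology:
  "topspace (hilb_topology d) = (hilb d :: ('n::finite, 'k::field) mpoly set set)"
proof
  show "topspace (hilb_topology d) \<subseteq> (hilb d :: ('n, 'k) mpoly set set)"
    by (auto simp: hilb_topology_def principal_open_def hilb_chart_def)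
  show "(hilb d :: ('n, 'k) mpoly set set) \<subseteq> topspace (hilb_topology d)"
  proof
    fix I :: "('n, 'k) mpoly set" assume I: "I \<in> hilb d"
    then obtain B where B: "poly_ideal.subspace I" "card B = d" "is_basis_mod I B"
      by (auto simp: hilb_def)
    obtain M where M: "finite M" "card M = d" "is_basis_mod I (monomial ` M)"
      using monomial_basis_mod[OF B(1,3)] B(2) by metis
    have "eval (chart_coord M I) 1 \<noteq> 0" by (simp add: subst_def)
    then have "I \<in> principal_open M 1"
      using I M by (simp add: principal_open_def hilb_chart_def)
    then show "I \<in> topspace (hilb_topology d)"
      using M by (auto simp: hilb_topology_def)
  qed
qed

definition vanishing_ideal :: "('n \<Rightarrow> 'k::field) set \<Rightarrow> ('n, 'k) mpoly set"
  where "vanishing_ideal P = {p. \<forall>x\<in>P. eval x p = 0}"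

definition smoothable_component :: "nat \<Rightarrow> ('n::finite, 'k::field) mpoly set set"
  where "smoothable_component d =
    hilb_topology d closure_of {vanishing_ideal P | P. finite P \<and> card P = d}"

section \<open>The translated one-step locus\<close>

definition quadratic_forms :: "('n, 'k::field) mpoly set"
  where "quadratic_forms =
    {p. \<forall>m\<in>Poly_Mapping.keys p. (\<Sum>v\<in>Poly_Mapping.keys m. Poly_Mapping.lookup m v) = 2}"

definition max_ideal :: "('n, 'k::field) mpoly set"
  where "max_ideal = poly_ideal.span (Set.range Var)"

definition max_ideal_cubed :: "('n, 'k::field) mpoly set"
  where "max_ideal_cubed =
    poly_ideal.span {f * g * h | f g h. f \<in> max_ideal \<and> g \<in> max_ideal \<and> h \<in> max_ideal}"

definition one_step_ideal :: "('n, 'k::field) mpoly set \<Rightarrow> ('n, 'k) mpoly set"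
  where "one_step_ideal Q = {p + q | p q. p \<in> poly_ideal.span Q \<and> q \<in> max_ideal_cubed}"

text \<open>
  The translate by the vector \<open>a\<close> of the subscheme with ideal \<open>I\<close> consists of the points \<open>x + a\<close>
  with \<open>x\<close> in that subscheme, so \<open>f\<close> belongs to its ideal iff \<open>f(x + a)\<close> belongs to \<open>I\<close>.
\<close>

definition translate :: "('n \<Rightarrow> 'k::field) \<Rightarrow> ('n, 'k) mpoly set \<Rightarrow> ('n, 'k) mpoly set"
  where "translate a I = {f. subst Const (\<lambda>i. Var i + Const (a i)) f \<in> I}"

text \<open>
  The codimension \<open>r\<close> condition on \<open>Q\<close> is stated additively, to avoid truncated subtraction.
  With \<open>n\<close> variables, the quotient by \<open>one_step_ideal Q\<close> has Hilbert function \<open>(1, n, r)\<close>.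
\<close>

definition translated_one_step_locus :: "nat \<Rightarrow> ('n::finite, 'k::field) mpoly set set"
  where "translated_one_step_locus r =
    hilb_topology (1 + CARD('n) + r) closure_of
      {translate a (one_step_ideal Q) | a Q.
         poly_vs.subspace Q \<and> Q \<subseteq> quadratic_forms \<and>
         poly_vs.dim Q + r = poly_vs.dim (quadratic_forms :: ('n, 'k) mpoly set)}"

end

theory Submission
  imports Defs "Jordan_Normal_Form.Determinant"
begin

text \<open>
  The ideal of the \<open>6 + r\<close> points \<open>0, s g e\<^sub>k, s g v\<^sub>j\<close> of affine 5-space degenerates for \<open>s \<rightarrow> 0\<close>
  to the one-step ideal \<open>I\<^sub>Q\<close> such that the space of dual quadrics annihilating \<open>Q\<close> is spanned
  by \<open>g (v\<^sub>j v\<^sub>j\<^sup>T - diag v\<^sub>j) g\<^sup>T\<close>, \<open>j < r\<close>. So it suffices that every tuple of \<open>r\<close> dual quadrics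
  lies in the closure of the image of
  \<open>(h, g, v) \<mapsto> (\<Sum>\<^sub>l h\<^sub>j\<^sub>l g (v\<^sub>l v\<^sub>l\<^sup>T - diag v\<^sub>l) g\<^sup>T)\<^sub>j\<close>, and for this it is enough that the differential of this
  polynomial map is surjective at one point \<open>(1, 1, v)\<close>: the lowest order term, at the image of that
  point, of a nonzero polynomial does not vanish along a suitable tangent direction, hence the
  polynomial does not vanish identically along a curve in the image with that tangent. For \<open>r \<ge> 10\<close>
  the vectors \<open>e\<^sub>a + e\<^sub>b\<close> work, since the off-diagonal quadrics are then all available; for \<open>r = 6, \<dots>, 9\<close>
  the rank is verified for explicit integer vectors.
\<close>

section \<open>Polynomial functions\<close>

text \<open>As a simplification rule this instance reads \<open>a * (b * x) = a * b * x\<close> and loops with associativity.\<close>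
declare poly_ideal.scale_scale [simp del]

text \<open>Closures are handled through neighbourhoods only. A family of ideals is given by
  functionals whose values on monomials are polynomial in a parameter, and an open set around one
  member contains every member at which a certain polynomial function is nonzero
  (\<open>hilb_open_polyfuns\<close>). \<open>polyfuns\<close> leaves the parameter type and the
  generators open because this is applied twice to the same neighbourhood: over all tuples of dual
  quadrics, to replace the given tuple by one coming from a configuration, and over the line of
  parameters \<open>s\<close>, to pass from \<open>s = 0\<close> to distinct points. The ranges of
  \<open>r\<close> reflect a count. The map has \<open>r^2 + 25 + 5 r\<close> parameters and a
  target of dimension \<open>15 r\<close>, and scaling \<open>g\<close> by \<open>c\<close> and
  \<open>h\<close> by \<open>c^-2\<close> changes nothing. At \<open>r = 5\<close> this leaves
  \<open>75 - 1 < 75\<close>, too few; at \<open>r = 6\<close> it leaves \<open>91 - 1 = 90\<close>,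
  with no slack. With \<open>g\<close> fixed, \<open>r^2 + 5 r \<ge> 15 r\<close> means
  \<open>r \<ge> 10\<close>, which is where the edge vectors take over.\<close>

inductive_set polyfuns :: "('t \<Rightarrow> 'k::comm_ring_1) set \<Rightarrow> ('t \<Rightarrow> 'k) set" for C
  where
    const: "(\<lambda>_. c) \<in> polyfuns C"
  | gen: "f \<in> C \<Longrightarrow> f \<in> polyfuns C"
  | add: "f \<in> polyfuns C \<Longrightarrow> g \<in> polyfuns C \<Longrightarrow> (\<lambda>t. f t + g t) \<in> polyfuns C"
  | mult: "f \<in> polyfuns C \<Longrightarrow> g \<in> polyfuns C \<Longrightarrow> (\<lambda>t. f t * g t) \<in> polyfuns C"

lemma polyfuns_minus: "f \<in> polyfuns C \<Longrightarrow> g \<in> polyfuns C \<Longrightarrow> (\<lambda>t. f t - g t) \<in> polyfuns C"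
  using polyfuns.add[of f C "\<lambda>t. (- 1) * g t"] polyfuns.mult[OF polyfuns.const[of "- 1" C]]
  by simp

lemma polyfuns_sum:
  "(\<And>i. i \<in> A \<Longrightarrow> (\<lambda>t. f i t) \<in> polyfuns C) \<Longrightarrow> (\<lambda>t. \<Sum>i\<in>A. f i t) \<in> polyfuns C"
  by (induction A rule: infinite_finite_induct) (simp_all add: polyfuns.const polyfuns.add)

lemma polyfuns_prod:
  "(\<And>i. i \<in> A \<Longrightarrow> (\<lambda>t. f i t) \<in> polyfuns C) \<Longrightarrow> (\<lambda>t. \<Prod>i\<in>A. f i t) \<in> polyfuns C"
  by (induction A rule: infinite_finite_induct) (simp_all add: polyfuns.const polyfuns.mult)

lemma polyfuns_power: "f \<in> polyfuns C \<Longrightarrow> (\<lambda>t. f t ^ n) \<in> polyfuns C"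
  by (induction n) (simp_all add: polyfuns.const polyfuns.mult)

lemma polyfuns_compose:
  assumes "f \<in> polyfuns C" and "\<And>g. g \<in> C \<Longrightarrow> (\<lambda>s. g (\<phi> s)) \<in> polyfuns C'"
  shows "(\<lambda>s. f (\<phi> s)) \<in> polyfuns C'"
  using assms(1) by induction (auto intro: polyfuns.intros assms(2))

lemmas polyfuns_intros =
  polyfuns.const polyfuns.add polyfuns.mult polyfuns_minus polyfuns_sum polyfuns_prod polyfuns_power

abbreviation (input) polyfuns1 :: "('k \<Rightarrow> 'k::comm_ring_1) set"
  where "polyfuns1 \<equiv> polyfuns {\<lambda>t. t}"

lemma polyfuns1_poly:
  "f \<in> polyfuns1 \<Longrightarrow> \<exists>p. \<forall>c. f c = poly p c"
proof (induction rule: polyfuns.induct)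
  case (const c)
  show ?case by (rule exI[of _ "[:c:]"]) simp
next
  case (gen f)
  then show ?case by (intro exI[of _ "[:0, 1:]"]) simp
next
  case (add f g)
  then show ?case by (metis poly_add)
next
  case (mult f g)
  then show ?case by (metis poly_mult)
qed

lemma poly_polyfuns1: "poly p \<in> polyfuns1"
proof (induction p)
  case 0
  then show ?case using polyfuns.const[of 0] by (simp add: fun_eq_iff[abs_def])
next
  case (pCons a p)
  have "(\<lambda>t. a + t * poly p t) \<in> polyfuns1"
    by (intro polyfuns_intros polyfuns.gen pCons) simp
  then show ?case by (simp add: fun_eq_iff[abs_def])
qed

lemma polyfuns1_finite_zeros:
  fixes f :: "'k::idom \<Rightarrow> 'k"
  assumes "f \<in> polyfuns1" "f c \<noteq> 0"
  shows "finite {t. f t = 0}"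
proof -
  obtain p where "\<forall>c. f c = poly p c" using polyfuns1_poly[OF assms(1)] by blast
  moreover from this have "p \<noteq> 0" using assms(2) by auto
  ultimately show ?thesis using poly_roots_finite[of p] by simp
qed

text \<open>The \<open>F i\<close> stand for the homogeneous parts of the Taylor expansion at
  \<open>y\<close>. What is recorded is that they are polynomial again, so that they can later be
  evaluated along a curve instead of at a fixed direction.\<close>

lemma polyfuns_expand_at:
  fixes f :: "('i \<Rightarrow> 'k::comm_ring_1) \<Rightarrow> 'k"
  assumes "f \<in> polyfuns (range (\<lambda>i w. w i))"
  shows "\<exists>N F. (\<forall>i. F i \<in> polyfuns (range (\<lambda>i w. w i))) \<and>
    (\<forall>c z. f (\<lambda>i. y i + c * z i) = (\<Sum>i\<le>N. c ^ i * F i z))"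
  using assms
proof induction
  case (const c)
  show ?case
    by (intro exI[of _ 0] exI[of _ "\<lambda>_ _. c"]) (simp add: polyfuns.const)
next
  case (gen f)
  then obtain i where i: "f = (\<lambda>w. w i)" by auto
  show ?case
    by (intro exI[of _ 1] exI[of _ "\<lambda>n. if n = 0 then (\<lambda>_. y i) else (\<lambda>w. w i)"])
      (simp add: i polyfuns.const polyfuns.gen)
next
  case (add f g)
  obtain N F where F: "\<And>i. F i \<in> polyfuns (range (\<lambda>i w. w i))"
    "\<And>c z. f (\<lambda>i. y i + c * z i) = (\<Sum>i\<le>N. c ^ i * F i z)" using add by blast
  obtain M G where G: "\<And>i. G i \<in> polyfuns (range (\<lambda>i w. w i))"
    "\<And>c z. g (\<lambda>i. y i + c * z i) = (\<Sum>i\<le>M. c ^ i * G i z)" using add by blast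
  \<comment> \<open>Beyond \<open>N\<close> and \<open>M\<close> the functions \<open>F i\<close>
    and \<open>G i\<close> are unconstrained, hence the cut-off before both sums are extended to
    \<open>N + M\<close>.\<close>
  define H where "H i = (\<lambda>z. (if i \<le> N then F i z else 0) + (if i \<le> M then G i z else 0))" for i
  have "H i \<in> polyfuns (range (\<lambda>i w. w i))" for i
    unfolding H_def using F(1)[of i] G(1)[of i]
    by (cases "i \<le> N"; cases "i \<le> M") (auto intro!: polyfuns.add polyfuns.const)
  moreover have "f (\<lambda>i. y i + c * z i) + g (\<lambda>i. y i + c * z i) = (\<Sum>i\<le>N + M. c ^ i * H i z)" for c z
  proof -
    have "(\<Sum>i\<le>N. c ^ i * F i z) = (\<Sum>i\<le>N + M. c ^ i * (if i \<le> N then F i z else 0))"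
      by (rule sum.mono_neutral_cong_left) auto
    moreover have "(\<Sum>i\<le>M. c ^ i * G i z) = (\<Sum>i\<le>N + M. c ^ i * (if i \<le> M then G i z else 0))"
      by (rule sum.mono_neutral_cong_left) auto
    ultimately show ?thesis by (simp add: F(2) G(2) H_def distrib_left sum.distrib)
  qed
  ultimately show ?case by blast
next
  case (mult f g)
  obtain N F where F: "\<And>i. F i \<in> polyfuns (range (\<lambda>i w. w i))"
    "\<And>c z. f (\<lambda>i. y i + c * z i) = (\<Sum>i\<le>N. c ^ i * F i z)" using mult by blast
  obtain M G where G: "\<And>i. G i \<in> polyfuns (range (\<lambda>i w. w i))"
    "\<And>c z. g (\<lambda>i. y i + c * z i) = (\<Sum>i\<le>M. c ^ i * G i z)" using mult by blast
  define H where "H k = (\<lambda>z. \<Sum>(i, j)\<in>{p \<in> {..N} \<times> {..M}. fst p + snd p = k}. F i z * G j z)" for k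
  have "H i \<in> polyfuns (range (\<lambda>i w. w i))" for i
    unfolding H_def by (intro polyfuns_sum) (auto intro!: polyfuns.mult F G)
  moreover have "f (\<lambda>i. y i + c * z i) * g (\<lambda>i. y i + c * z i) = (\<Sum>k\<le>N + M. c ^ k * H k z)" for c z
  proof -
    have interchange: "a * b * (p * q) = a * p * (b * q)" for a b p q :: 'k
      by (simp only: mult.assoc mult.left_commute)
    have "(\<Sum>k\<le>N + M. c ^ k * H k z)
        = (\<Sum>k\<le>N + M. \<Sum>p\<in>{p \<in> {..N} \<times> {..M}. fst p + snd p = k}.
             c ^ (fst p + snd p) * (F (fst p) z * G (snd p) z))"
      unfolding H_def sum_distrib_left by (intro sum.cong refl) (auto simp: case_prod_beta)
    also have "\<dots> = (\<Sum>p\<in>{..N} \<times> {..M}. c ^ (fst p + snd p) * (F (fst p) z * G (snd p) z))"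
      by (rule sum.group) auto
    also have "\<dots> = (\<Sum>p\<in>{..N} \<times> {..M}. case p of (i, j) \<Rightarrow> (c ^ i * F i z) * (c ^ j * G j z))"
      by (rule sum.cong[OF refl]) (clarify, simp only: power_add fst_conv snd_conv interchange)
    also have "\<dots> = (\<Sum>i\<le>N. c ^ i * F i z) * (\<Sum>j\<le>M. c ^ j * G j z)"
      by (simp only: sum_product sum.cartesian_product)
    finally show ?thesis by (simp add: F(2) G(2))
  qed
  ultimately show ?case by blast
qed

text \<open>A curve has the form \<open>y + c q(c)\<close> with \<open>q(0) = z\<close>. If
  \<open>e\<close> is the lowest order in which \<open>f\<close> has a nonzero coefficient function
  at \<open>y\<close>, and \<open>z\<close> is chosen with \<open>F e z \<noteq> 0\<close>, then
  \<open>f\<close> along the curve is \<open>c ^ e\<close> times a polynomial with value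
  \<open>F e z\<close> at 0. So only the value and the first derivative of the curve at 0
  matter.\<close>

lemma polyfuns_nonzero_direction:
  fixes f :: "('i \<Rightarrow> 'k::field_char_0) \<Rightarrow> 'k"
  assumes f: "f \<in> polyfuns (range (\<lambda>i w. w i))" and "f x \<noteq> 0"
  obtains z where "\<And>p. (\<And>i. coeff (p i) 0 = y i) \<Longrightarrow> (\<And>i. coeff (p i) 1 = z i) \<Longrightarrow>
    finite {c. f (\<lambda>i. poly (p i) c) = 0}"
proof -
  obtain N F where FP: "\<And>i. F i \<in> polyfuns (range (\<lambda>i w. w i))"
    and F: "\<And>c z. f (\<lambda>i. y i + c * z i) = (\<Sum>i\<le>N. c ^ i * F i z)"
    using polyfuns_expand_at[OF f, of y] by blast
  define e where "e = (LEAST i. i \<le> N \<and> (\<exists>z. F i z \<noteq> 0))"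
  \<comment> \<open>At \<open>c = 1\<close> in the direction from \<open>y\<close> to
    \<open>x\<close> the expansion sums to \<open>f x\<close>.\<close>
  have "\<exists>i. i \<le> N \<and> (\<exists>z. F i z \<noteq> 0)"
    using F[of 1 "\<lambda>i. x i - y i"] \<open>f x \<noteq> 0\<close> by (auto intro: ccontr)
  from LeastI_ex[OF this, folded e_def] obtain z where e: "e \<le> N" "F e z \<noteq> 0" by blast
  have low: "F i z = 0" if "i < e" for i z
    using not_less_Least[of i "\<lambda>i. i \<le> N \<and> (\<exists>z. F i z \<noteq> 0)"] that e(1)
    unfolding e_def[symmetric] by auto
  show thesis
  proof
    fix p :: "'i \<Rightarrow> 'k poly"
    assume p0: "\<And>i. coeff (p i) 0 = y i" and p1: "\<And>i. coeff (p i) 1 = z i"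
    define q where "q i = poly_shift 1 (p i)" for i
    have pq: "p i = pCons (y i) (q i)" for i
      by (rule poly_eqI) (simp add: q_def coeff_poly_shift coeff_pCons p0 split: nat.split)
    have q0: "poly (q i) 0 = z i" for i
      using p1[of i] by (simp add: q_def poly_0_coeff_0 coeff_poly_shift)
    define P where "P c = (\<Sum>i\<in>{e..N}. c ^ (i - e) * F i (\<lambda>i. poly (q i) c))" for c
    have eq: "f (\<lambda>i. poly (p i) c) = c ^ e * P c" for c
    proof -
      have "f (\<lambda>i. poly (p i) c) = (\<Sum>i\<le>N. c ^ i * F i (\<lambda>i. poly (q i) c))"
        by (simp add: pq F)
      also have "\<dots> = (\<Sum>i\<in>{e..N}. c ^ i * F i (\<lambda>i. poly (q i) c))"
        by (rule sum.mono_neutral_right) (auto simp: low)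
      also have "\<dots> = c ^ e * P c"
        by (auto simp: P_def sum_distrib_left mult.assoc[symmetric] simp flip: power_add intro!: sum.cong)
      finally show ?thesis .
    qed
    have "P \<in> polyfuns1"
      unfolding P_def[abs_def]
      by (intro polyfuns_intros polyfuns_compose[OF FP])
        (auto intro: polyfuns.gen poly_polyfuns1)
    moreover have "P 0 \<noteq> 0"
    proof -
      have "P 0 = (\<Sum>i\<in>{e..N}. if i = e then F e z else 0)"
        unfolding P_def by (intro sum.cong) (auto simp: q0 power_0_left)
      then show ?thesis using e by simp
    qed
    ultimately have "finite {c. P c = 0}" by (rule polyfuns1_finite_zeros)
    then have "finite (insert 0 {c. P c = 0})" by simp
    then show "finite {c. f (\<lambda>i. poly (p i) c) = 0}"
      by (rule rev_finite_subset) (auto simp: eq)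
  qed
qed

section \<open>Determinants and adjugates with polynomial entries\<close>

lemma polyfuns_det:
  assumes "\<And>i j. i < n \<Longrightarrow> j < n \<Longrightarrow> (\<lambda>t. A t i j) \<in> polyfuns C"
  shows "(\<lambda>t. det (mat n n (\<lambda>(i, j). A t i j))) \<in> polyfuns C"
proof -
  have "det (mat n n (\<lambda>(i, j). A t i j))
      = (\<Sum>p\<in>{p. p permutes {0..<n}}. signof p * (\<Prod>i = 0..<n. A t i (p i)))" for t
    by (subst det_def'[of _ n]) (auto intro!: sum.cong prod.cong simp: permutes_in_image)
  then show ?thesis
    by (simp only:) (intro polyfuns_intros assms; simp add: permutes_in_image)
qed

lemma polyfuns_cofactor:
  assumes A: "\<And>i j. i < n \<Longrightarrow> j < n \<Longrightarrow> (\<lambda>t. A t i j) \<in> polyfuns C" and "k < n" "l < n"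
  shows "(\<lambda>t. cofactor (mat n n (\<lambda>(i, j). A t i j)) k l) \<in> polyfuns C"
proof -
  have "mat_delete (mat n n (\<lambda>(i, j). A t i j)) k l
      = mat (n - 1) (n - 1) (\<lambda>(i, j). A t (if i < k then i else Suc i) (if j < l then j else Suc j))" for t
    unfolding mat_delete_def by (rule eq_matI) auto
  then have "cofactor (mat n n (\<lambda>(i, j). A t i j)) k l = (- 1) ^ (k + l) *
      det (mat (n - 1) (n - 1) (\<lambda>(i, j). A t (if i < k then i else Suc i) (if j < l then j else Suc j)))" for t
    unfolding cofactor_def by simp
  then show ?thesis
    by (simp only:) (intro polyfuns.mult polyfuns.const polyfuns_det A; auto)
qed

text \<open>Cramer's rule without division: \<open>D\<close> is the determinant and \<open>N\<close>
  the adjugate, both polynomial in the parameter, while invertibility is assumed at the single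
  parameter \<open>t0\<close>. The index sets are arbitrary because rows will be functionals and
  columns exponent vectors.\<close>

lemma polyfuns_adjugate:
  fixes A :: "'t \<Rightarrow> 'b \<Rightarrow> 'm \<Rightarrow> 'k::field"
  assumes fin: "finite X" "finite Y" "card X = card Y"
    and A: "\<And>x y. x \<in> X \<Longrightarrow> y \<in> Y \<Longrightarrow> (\<lambda>t. A t x y) \<in> polyfuns C"
    and inj: "\<And>c. (\<And>x. x \<in> X \<Longrightarrow> (\<Sum>y\<in>Y. A t0 x y * c y) = 0) \<Longrightarrow> (\<And>y. y \<in> Y \<Longrightarrow> c y = 0)"
  obtains D N where "D \<in> polyfuns C" "\<And>x y. x \<in> X \<Longrightarrow> y \<in> Y \<Longrightarrow> (\<lambda>t. N t y x) \<in> polyfuns C" "D t0 \<noteq> 0"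
    "\<And>t x x'. x \<in> X \<Longrightarrow> x' \<in> X \<Longrightarrow> (\<Sum>y\<in>Y. A t x y * N t y x') = (if x = x' then D t else 0)"
    "\<And>t y y'. y \<in> Y \<Longrightarrow> y' \<in> Y \<Longrightarrow> (\<Sum>x\<in>X. N t y x * A t x y') = (if y = y' then D t else 0)"
proof -
  define n where "n = card X"
  obtain f where f: "bij_betw f {0..<n} X"
    using ex_bij_betw_nat_finite[OF fin(1)] n_def by blast
  obtain g where g: "bij_betw g {0..<n} Y"
    using ex_bij_betw_nat_finite[OF fin(2)] fin(3) n_def by metis
  define f' where "f' = the_inv_into {0..<n} f"
  define g' where "g' = the_inv_into {0..<n} g"
  have f': "f' x < n" "f (f' x) = x" if "x \<in> X" for x
    using that bij_betwE[OF bij_betw_the_inv_into[OF f]] f_the_inv_into_f_bij_betw[OF f]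
    by (auto simp: f'_def)
  have g': "g' y < n" "g (g' y) = y" if "y \<in> Y" for y
    using that bij_betwE[OF bij_betw_the_inv_into[OF g]] f_the_inv_into_f_bij_betw[OF g]
    by (auto simp: g'_def)
  have fX: "f i \<in> X" "f' (f i) = i" if "i < n" for i
    using f that by (auto simp: f'_def bij_betw_def the_inv_into_f_f)
  have gY: "g i \<in> Y" "g' (g i) = i" if "i < n" for i
    using g that by (auto simp: g'_def bij_betw_def the_inv_into_f_f)
  define B where "B t = mat n n (\<lambda>(i, j). A t (f i) (g j))" for t
  have B: "B t \<in> carrier_mat n n" for t by (simp add: B_def)
  define N where "N t y x = adj_mat (B t) $$ (g' y, f' x)" for t y x
  have sY: "(\<Sum>y\<in>Y. h y) = (\<Sum>i = 0..<n. h (g i))" for h :: "'m \<Rightarrow> 'k"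
    using sum.reindex_bij_betw[OF g] by metis
  have sX: "(\<Sum>x\<in>X. h x) = (\<Sum>i = 0..<n. h (f i))" for h :: "'b \<Rightarrow> 'k"
    using sum.reindex_bij_betw[OF f] by metis
  show thesis
  proof
    show "(\<lambda>t. det (B t)) \<in> polyfuns C"
      unfolding B_def by (intro polyfuns_det A fX gY)
    show "(\<lambda>t. N t y x) \<in> polyfuns C" if "x \<in> X" "y \<in> Y" for x y
    proof -
      have "N t y x = cofactor (B t) (f' x) (g' y)" for t
        using that by (simp add: N_def adj_mat_def B_def f' g')
      then show ?thesis
        unfolding B_def by (simp only:) (intro polyfuns_cofactor A fX gY f' g' that)
    qed
    show "det (B t0) \<noteq> 0"
    proof
      assume "det (B t0) = 0"
      then obtain v where v: "v \<in> carrier_vec n" "v \<noteq> 0\<^sub>v n" "B t0 *\<^sub>v v = 0\<^sub>v n"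
        using det_0_iff_vec_prod_zero[OF B] by blast
      have "(\<Sum>y\<in>Y. A t0 x y * v $ g' y) = 0" if "x \<in> X" for x
      proof -
        have "(B t0 *\<^sub>v v) $ f' x = (\<Sum>i = 0..<n. A t0 x (g i) * v $ i)"
          using v(1) that by (auto simp: B_def scalar_prod_def f' intro!: sum.cong)
        then show ?thesis using v(3) that by (simp add: sY gY f')
      qed
      then have "v $ g' y = 0" if "y \<in> Y" for y using inj[of "\<lambda>y. v $ g' y"] that by blast
      then have "v $ i = 0" if "i < n" for i using gY[OF that] by metis
      then have "v = 0\<^sub>v n" using v(1) by (intro eq_vecI) auto
      then show False using v(2) by simp
    qed
    show "(\<Sum>y\<in>Y. A t x y * N t y x') = (if x = x' then det (B t) else 0)"
      if "x \<in> X" "x' \<in> X" for t x x'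
    proof -
      have "(B t * adj_mat (B t)) $$ (f' x, f' x') = (\<Sum>y\<in>Y. A t x y * N t y x')"
        using that adj_mat(1)[OF B[of t]]
        by (simp add: sY N_def B_def scalar_prod_def f' gY)
      moreover have "f' x = f' x' \<longleftrightarrow> x = x'" using that f'(2) by metis
      ultimately show ?thesis using that f' adj_mat(2)[OF B[of t]] by (simp split: if_splits)
    qed
    show "(\<Sum>x\<in>X. N t y x * A t x y') = (if y = y' then det (B t) else 0)"
      if "y \<in> Y" "y' \<in> Y" for t y y'
    proof -
      have "(adj_mat (B t) * B t) $$ (g' y, g' y') = (\<Sum>x\<in>X. N t y x * A t x y')"
        using that adj_mat(1)[OF B[of t]]
        by (simp add: sX N_def B_def scalar_prod_def g' fX)
      moreover have "g' y = g' y' \<longleftrightarrow> y = y'" using that g'(2) by metis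
      ultimately show ?thesis using that g' adj_mat(3)[OF B[of t]] by (simp split: if_splits)
    qed
  qed
qed

section \<open>Open neighbourhoods in the Hilbert scheme\<close>

definition power_vec :: "('v \<Rightarrow> 'b::comm_monoid_mult) \<Rightarrow> ('v \<Rightarrow>\<^sub>0 nat) \<Rightarrow> 'b"
  where "power_vec x m = (\<Prod>v\<in>Poly_Mapping.keys m. x v ^ Poly_Mapping.lookup m v)"

lemma power_vec_UNIV: "power_vec x m = (\<Prod>v\<in>UNIV. x v ^ Poly_Mapping.lookup m v)"
  for m :: "'v::finite \<Rightarrow>\<^sub>0 nat"
  unfolding power_vec_def by (rule prod.mono_neutral_left) (auto simp: in_keys_iff)

lemma power_vec_add: "power_vec x (m + n) = power_vec x m * power_vec x n"
  for m :: "'v::finite \<Rightarrow>\<^sub>0 nat"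
  by (simp add: power_vec_UNIV lookup_add power_add prod.distrib)

lemma power_vec_zero [simp]: "power_vec x 0 = 1"
  by (simp add: power_vec_def)

lemma power_vec_single [simp]: "power_vec x (Poly_Mapping.single i n) = x i ^ n"
  by (simp add: power_vec_def)

lemma scale_monomial: "scale c (monomial m) = Poly_Mapping.single m c"
  for c :: "'k::field"
  by (simp add: scale_def Const_def monomial_def mult_single)

lemma lookup_scale [simp]: "Poly_Mapping.lookup (scale c p) m = c * Poly_Mapping.lookup p m"
  for c :: "'k::field"
proof -
  have "scale c p = Poly_Mapping.map ((*) c) p"
    by (simp add: scale_def Const_def mult_map_scale_conv_mult)
  then show ?thesis by (simp add: Poly_Mapping.map.rep_eq when_def)
qed

lemma subst_eq_sum:
  assumes "h 0 = 0" "finite S" "Poly_Mapping.keys p \<subseteq> S"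
  shows "subst h x p = (\<Sum>m\<in>S. h (Poly_Mapping.lookup p m) * power_vec x m)"
  unfolding subst_def power_vec_def
  by (rule sum.mono_neutral_left) (use assms in \<open>auto simp: in_keys_iff\<close>)

text \<open>Two instances occur: the identity, giving evaluation at a point, and
  \<open>Const\<close>, giving substitution of polynomials.\<close>

context
  fixes h :: "'k::field \<Rightarrow> 'b::comm_semiring_1"
  assumes h0: "h 0 = 0" and h_add: "\<And>a b. h (a + b) = h a + h b"
    and h_mult: "\<And>a b. h (a * b) = h a * h b"
begin

lemma subst_add: "subst h x (p + q) = subst h x p + subst h x q"
proof -
  let ?S = "Poly_Mapping.keys p \<union> Poly_Mapping.keys q"
  have "Poly_Mapping.keys (p + q) \<subseteq> ?S" by (rule keys_add)
  then show ?thesis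
    by (simp add: subst_eq_sum[of h ?S] h0 h_add lookup_add distrib_right sum.distrib)
qed

lemma subst_sum: "subst h x (\<Sum>i\<in>A. f i) = (\<Sum>i\<in>A. subst h x (f i))"
  by (induction A rule: infinite_finite_induct) (simp_all add: subst_add, simp_all add: subst_def)

lemma subst_single: "subst h x (Poly_Mapping.single m c) = h c * power_vec x m"
  by (simp add: subst_eq_sum[of h "{m}"] h0)

lemma subst_mult: "subst h x (p * q) = subst h x p * subst h x q"
  for p q :: "('v::finite, 'k) mpoly"
proof -
  have single: "subst h x (Poly_Mapping.single m c * q) = h c * power_vec x m * subst h x q" for m c
  proof -
    have "Poly_Mapping.single m c * q =
        (\<Sum>n\<in>Poly_Mapping.keys q. Poly_Mapping.single (m + n) (c * Poly_Mapping.lookup q n))"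
      by (subst poly_eq_sum_monomials[of q]) (simp add: scale_monomial sum_distrib_left mult_single)
    also have "subst h x \<dots> = (\<Sum>n\<in>Poly_Mapping.keys q. h c * power_vec x m *
        (h (Poly_Mapping.lookup q n) * power_vec x n))"
      by (simp add: subst_sum subst_single power_vec_add h_mult mult_ac)
    also have "\<dots> = h c * power_vec x m * subst h x q"
      by (simp add: subst_def power_vec_def sum_distrib_left)
    finally show ?thesis .
  qed
  have "subst h x (p * q) = (\<Sum>m\<in>Poly_Mapping.keys p. h (Poly_Mapping.lookup p m) * power_vec x m * subst h x q)"
    by (subst poly_eq_sum_monomials[of p]) (simp add: scale_monomial sum_distrib_right subst_sum single)
  also have "\<dots> = subst h x p * subst h x q"
    by (simp add: subst_def power_vec_def sum_distrib_right)
  finally show ?thesis .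
qed

end

lemma Const_add: "Const (a + b) = Const a + Const b"
  by (simp add: Const_def single_add)

lemma Const_mult: "Const (a * b) = Const a * Const b"
  by (simp add: Const_def mult_single)

lemma Const_0 [simp]: "Const 0 = 0"
  by (simp add: Const_def)

definition linear_functional :: "(('v, 'k::field) mpoly \<Rightarrow> 'k) \<Rightarrow> bool"
  where "linear_functional L \<longleftrightarrow> (\<forall>p q. L (p + q) = L p + L q) \<and> (\<forall>c p. L (scale c p) = c * L p)"

lemma linear_functionalI:
  "(\<And>p q. L (p + q) = L p + L q) \<Longrightarrow> (\<And>c p. L (scale c p) = c * L p) \<Longrightarrow> linear_functional L"
  by (simp add: linear_functional_def)

context
  fixes L :: "('v, 'k::field) mpoly \<Rightarrow> 'k"
  assumes L: "linear_functional L"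
begin

lemma linear_functional_add: "L (p + q) = L p + L q"
  and linear_functional_scale: "L (scale c p) = c * L p"
  using L by (auto simp: linear_functional_def)

lemma linear_functional_0: "L 0 = 0"
  using linear_functional_scale[of 0 0] by simp

lemma linear_functional_diff: "L (p - q) = L p - L q"
  using linear_functional_add[of "p - q" q] by simp

lemma linear_functional_sum: "L (\<Sum>i\<in>A. f i) = (\<Sum>i\<in>A. L (f i))"
  by (induction A rule: infinite_finite_induct) (simp_all add: linear_functional_0 linear_functional_add)

end

lemma eval_add: "eval x (p + q) = eval x p + eval x q"
  for p q :: "('v, 'k::field) mpoly"
  by (rule subst_add) simp_all

lemma eval_monomial [simp]: "eval x (monomial m) = power_vec x m"
  by (simp add: subst_def monomial_def power_vec_def)

lemma eval_Const [simp]: "eval x (Const c) = c"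
  by (simp add: Const_def subst_def)

lemma eval_0 [simp]: "eval x 0 = 0"
  by (simp add: subst_def)

lemma eval_sum: "eval x (\<Sum>i\<in>A. f i) = (\<Sum>i\<in>A. eval x (f i))"
  for f :: "'i \<Rightarrow> ('v, 'k::field) mpoly"
  by (rule subst_sum) simp_all

lemma eval_mult: "eval x (p * q) = eval x p * eval x q"
  for p q :: "('v::finite, 'k::field) mpoly"
  by (rule subst_mult) simp_all

lemma eval_power_vec: "eval x (power_vec y m) = power_vec (\<lambda>v. eval x (y v)) m"
  for y :: "'v \<Rightarrow> ('n::finite, 'k::field) mpoly"
proof -
  have one: "eval x 1 = 1" for x :: "'n \<Rightarrow> 'k"
    using eval_Const[of x 1] by (simp add: Const_def)
  have pow: "eval x (p ^ n) = eval x p ^ n" for p :: "('n, 'k) mpoly" and n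
    by (induction n) (simp_all add: eval_mult one)
  have "eval x (prod f A) = (\<Prod>i\<in>A. eval x (f i))" for f :: "'v \<Rightarrow> ('n, 'k) mpoly" and A
    by (induction A rule: infinite_finite_induct) (simp_all add: eval_mult one)
  then show ?thesis by (simp add: power_vec_def pow)
qed

lemma eval_subst: "eval x (subst Const y p) = eval (\<lambda>v. eval x (y v)) p"
  for y :: "'v \<Rightarrow> ('n::finite, 'k::field) mpoly"
  unfolding subst_def[of Const] subst_def[of "\<lambda>c. c" "\<lambda>v. eval x (y v)"]
  by (simp add: eval_sum eval_mult eval_power_vec flip: power_vec_def)

lemma subst_Const_add: "subst Const y (p + q) = subst Const y p + subst Const y q"
  for y :: "'v \<Rightarrow> ('n, 'k::field) mpoly"
  by (rule subst_add) (simp_all add: Const_add Const_mult)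

lemma subst_Const_scale: "subst Const y (scale c p) = scale c (subst Const y p)"
  for y :: "'v \<Rightarrow> ('n, 'k::field) mpoly"
proof -
  have "Poly_Mapping.keys (scale c p) \<subseteq> Poly_Mapping.keys p"
    by (auto simp: in_keys_iff)
  then show ?thesis
    by (simp add: subst_eq_sum[of Const "Poly_Mapping.keys p"] scale_def[of c "sum _ _"]
        Const_mult sum_distrib_left mult.assoc)
qed

lemma linear_functional_subst:
  "linear_functional L \<Longrightarrow> linear_functional (\<lambda>p. L (subst Const y p))"
  for y :: "'v \<Rightarrow> ('n, 'k::field) mpoly"
  by (rule linear_functionalI)
    (simp_all add: subst_Const_add subst_Const_scale linear_functional_add linear_functional_scale)

section \<open>Pulling back open sets along families of functionals\<close>

lemma inj_monomial: "inj (monomial :: _ \<Rightarrow> ('v, 'k::field) mpoly)"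
  unfolding monomial_def inj_def by (metis keys_single singleton_inject zero_neq_one)

text \<open>Chart coordinates along a family are quotients by powers of a determinant
  \<open>D\<close>. Where \<open>D\<close> does not vanish, multiplying by a power of
  \<open>D\<close> turns a polynomial in them into a polynomial function with the same
  zeros.\<close>

lemma polyfuns_clear_denominators:
  fixes D :: "'t \<Rightarrow> 'k::field"
  assumes "D \<in> polyfuns C" and "f \<in> polyfuns (insert (\<lambda>t. inverse (D t)) C)"
  shows "\<exists>K P. P \<in> polyfuns C \<and> (\<forall>t. D t \<noteq> 0 \<longrightarrow> f t * D t ^ K = P t)"
  using assms(2)
proof induction
  case (const c)
  show ?case by (intro exI[of _ 0] exI[of _ "\<lambda>_. c"]) (simp add: polyfuns.const)
next
  case (gen f)
  then consider "f = (\<lambda>t. inverse (D t))" | "f \<in> C" by blast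
  then show ?case
  proof cases
    case 1
    then show ?thesis by (intro exI[of _ 1] exI[of _ "\<lambda>_. 1"]) (simp add: polyfuns.const)
  next
    case 2
    then show ?thesis by (intro exI[of _ 0] exI[of _ f]) (simp add: polyfuns.gen)
  qed
next
  case (add f g)
  then obtain K P K' P' where P: "P \<in> polyfuns C" "\<And>t. D t \<noteq> 0 \<Longrightarrow> f t * D t ^ K = P t"
    and P': "P' \<in> polyfuns C" "\<And>t. D t \<noteq> 0 \<Longrightarrow> g t * D t ^ K' = P' t" by blast
  have "(\<lambda>t. P t * D t ^ K' + P' t * D t ^ K) \<in> polyfuns C"
    by (intro polyfuns_intros P P' assms)
  moreover have "(f t + g t) * D t ^ (K + K') = P t * D t ^ K' + P' t * D t ^ K" if "D t \<noteq> 0" for t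
    unfolding P(2)[OF that, symmetric] P'(2)[OF that, symmetric] by (simp add: power_add algebra_simps)
  ultimately show ?case by blast
next
  case (mult f g)
  then obtain K P K' P' where P: "P \<in> polyfuns C" "\<And>t. D t \<noteq> 0 \<Longrightarrow> f t * D t ^ K = P t"
    and P': "P' \<in> polyfuns C" "\<And>t. D t \<noteq> 0 \<Longrightarrow> g t * D t ^ K' = P' t" by blast
  have "(\<lambda>t. P t * P' t) \<in> polyfuns C"
    by (intro polyfuns_intros P P')
  moreover have "(f t * g t) * D t ^ (K + K') = P t * P' t" if "D t \<noteq> 0" for t
    unfolding P(2)[OF that, symmetric] P'(2)[OF that, symmetric] by (simp add: power_add algebra_simps)
  ultimately show ?case by blast
qed

definition common_zeros :: "('b \<Rightarrow> ('v, 'k::field) mpoly \<Rightarrow> 'k) \<Rightarrow> 'b set \<Rightarrow> ('v, 'k) mpoly set"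
  where "common_zeros L B = {f. \<forall>b\<in>B. L b f = 0}"

definition independent_on :: "('b \<Rightarrow> ('v, 'k::field) mpoly \<Rightarrow> 'k) \<Rightarrow> 'b set \<Rightarrow> bool"
  where "independent_on L B \<longleftrightarrow> (\<forall>c. (\<forall>f. (\<Sum>b\<in>B. c b * L b f) = 0) \<longrightarrow> (\<forall>b\<in>B. c b = 0))"

text \<open>Since \<open>M\<close> is a basis modulo the ideal at \<open>t0\<close>, the square
  matrix of the functionals on the monomials of \<open>M\<close> is invertible there. Wherever its
  determinant \<open>D\<close> is nonzero, \<open>M\<close> stays a basis, the functionals are
  independent, and Cramer's rule expresses the chart coordinates by the adjugate divided by
  \<open>D\<close>. So \<open>G\<close> is \<open>D\<close> times the numerator of \<open>F\<close>
  in these coordinates.\<close>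

lemma principal_open_polyfuns:
  fixes L :: "'t \<Rightarrow> 'b \<Rightarrow> ('n::finite, 'k::field) mpoly \<Rightarrow> 'k"
  assumes lin: "\<And>t b. linear_functional (L t b)"
    and poly: "\<And>b m. b \<in> B \<Longrightarrow> (\<lambda>t. L t b (monomial m)) \<in> polyfuns C"
    and B: "finite B" and M: "finite M" "card M = card B"
    and t0: "common_zeros (L t0) B \<in> principal_open M F"
  shows "\<exists>G. G \<in> polyfuns C \<and> G t0 \<noteq> 0 \<and> (\<forall>t. G t \<noteq> 0 \<longrightarrow> independent_on (L t) B \<and>
    (poly_ideal.subspace (common_zeros (L t) B) \<longrightarrow> common_zeros (L t) B \<in> principal_open M F))"
proof -
  let ?J = "\<lambda>t. common_zeros (L t) B"
  let ?M = "monomial ` M :: ('n, 'k) mpoly set"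
  have injM: "inj_on (monomial :: _ \<Rightarrow> ('n, 'k) mpoly) M"
    using inj_monomial by (rule inj_on_subset) simp
  have mem_M: "monomial m \<in> ?M \<longleftrightarrow> m \<in> M" for m
    using inj_monomial by (auto dest: injD)
  have sumM: "(\<Sum>b\<in>?M. g b) = (\<Sum>m\<in>M. g (monomial m))" for g :: "_ \<Rightarrow> ('n, 'k) mpoly"
    by (simp add: sum.reindex[OF injM])
  have J_iff: "p - (\<Sum>b\<in>?M. scale (c b) b) \<in> ?J t \<longleftrightarrow>
      (\<forall>b\<in>B. (\<Sum>m\<in>M. L t b (monomial m) * c (monomial m)) = L t b p)" for p c t
    unfolding sumM common_zeros_def
    by (auto simp: linear_functional_diff[OF lin] linear_functional_sum[OF lin]
        linear_functional_scale[OF lin] mult.commute[of _ "c _"])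
  have basis: "is_basis_mod (?J t0) ?M" and nz: "eval (chart_coord M (?J t0)) F \<noteq> 0"
    using t0 by (auto simp: principal_open_def hilb_chart_def)
  have inj: "c m = 0" if c: "\<And>b. b \<in> B \<Longrightarrow> (\<Sum>m\<in>M. L t0 b (monomial m) * c m) = 0" and m: "m \<in> M" for c m
  proof -
    \<comment> \<open>A relation among the columns is an expansion of 0; it is extended by 0 because
      \<open>is_expansion_mod\<close> prescribes the value 0 off the basis.\<close>
    define c' where "c' q = (if q \<in> ?M then c (inv_into UNIV monomial q) else 0)" for q :: "('n, 'k) mpoly"
    have c': "c' (monomial m) = c m" if "m \<in> M" for m
      using that by (simp add: c'_def inv_f_f[OF inj_monomial])
    have "is_expansion_mod (?J t0) ?M 0 c'"
      unfolding is_expansion_mod_def J_iff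
      by (auto simp: c'_def inv_f_f[OF inj_monomial] c linear_functional_0[OF lin])
    moreover have "is_expansion_mod (?J t0) ?M 0 (\<lambda>_. 0)"
      unfolding is_expansion_mod_def J_iff by (simp add: linear_functional_0[OF lin])
    ultimately have "c' = (\<lambda>_. 0)" using basis unfolding is_basis_mod_def by blast
    then show ?thesis using c'[OF m] by simp
  qed
  obtain D N where D1: "D \<in> polyfuns C"
    and N: "\<And>b m. b \<in> B \<Longrightarrow> m \<in> M \<Longrightarrow> (\<lambda>t. N t m b) \<in> polyfuns C"
    and D2: "D t0 \<noteq> 0"
    and AN: "\<And>t b b'. b \<in> B \<Longrightarrow> b' \<in> B \<Longrightarrow>
      (\<Sum>m\<in>M. L t b (monomial m) * N t m b') = (if b = b' then D t else 0)"
    and NA: "\<And>t m m'. m \<in> M \<Longrightarrow> m' \<in> M \<Longrightarrow>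
      (\<Sum>b\<in>B. N t m b * L t b (monomial m')) = (if m = m' then D t else 0)"
  proof (rule polyfuns_adjugate[of B M "\<lambda>t b m. L t b (monomial m)" C t0, OF B M(1) M(2)[symmetric]])
    show "(\<lambda>t. L t b (monomial m)) \<in> polyfuns C" if "b \<in> B" for b m
      using that by (rule poly)
    show "c m = 0" if "\<And>b. b \<in> B \<Longrightarrow> (\<Sum>m\<in>M. L t0 b (monomial m) * c m) = 0" "m \<in> M" for c m
      using that by (rule inj)
  qed (rule that; assumption)
  note D = D1 D2
  have exp_iff: "is_expansion_mod (?J t) ?M p c \<longleftrightarrow> (\<forall>q. q \<notin> ?M \<longrightarrow> c q = 0) \<and>
      (\<forall>m\<in>M. c (monomial m) = (\<Sum>b\<in>B. N t m b * L t b p) * inverse (D t))"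
    (is "_ \<longleftrightarrow> _ \<and> ?R") if Dt: "D t \<noteq> 0" for t p c
  proof -
    have "(\<forall>b\<in>B. (\<Sum>m\<in>M. L t b (monomial m) * c (monomial m)) = L t b p) \<longleftrightarrow> ?R" (is "?l \<longleftrightarrow> _")
    proof
      assume l: ?l
      show ?R
      proof
        fix m assume m: "m \<in> M"
        have "(\<Sum>b\<in>B. N t m b * L t b p)
            = (\<Sum>b\<in>B. \<Sum>m'\<in>M. N t m b * L t b (monomial m') * c (monomial m'))"
          using l by (intro sum.cong refl) (auto simp: sum_distrib_left mult.assoc simp flip: l)
        also have "\<dots> = (\<Sum>m'\<in>M. (\<Sum>b\<in>B. N t m b * L t b (monomial m')) * c (monomial m'))"
          by (subst sum.swap) (simp add: sum_distrib_right)
        also have "\<dots> = (\<Sum>m'\<in>M. if m = m' then D t * c (monomial m') else 0)"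
          by (intro sum.cong refl) (simp add: NA m)
        also have "\<dots> = D t * c (monomial m)" using m M(1) by simp
        finally show "c (monomial m) = (\<Sum>b\<in>B. N t m b * L t b p) * inverse (D t)"
          using Dt by simp
      qed
    next
      assume r: ?R
      show ?l
      proof
        fix b assume b: "b \<in> B"
        have "(\<Sum>m\<in>M. L t b (monomial m) * c (monomial m))
            = (\<Sum>m\<in>M. \<Sum>b'\<in>B. L t b (monomial m) * N t m b' * (L t b' p * inverse (D t)))"
          using r by (intro sum.cong refl) (simp add: sum_distrib_left sum_distrib_right mult.assoc)
        also have "\<dots> = (\<Sum>b'\<in>B. (\<Sum>m\<in>M. L t b (monomial m) * N t m b') * (L t b' p * inverse (D t)))"
          by (subst sum.swap) (simp add: sum_distrib_right)
        also have "\<dots> = (\<Sum>b'\<in>B. if b = b' then D t * (L t b' p * inverse (D t)) else 0)"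
          by (intro sum.cong refl) (simp add: AN b)
        also have "\<dots> = L t b p" using b B Dt by simp
        finally show "(\<Sum>m\<in>M. L t b (monomial m) * c (monomial m)) = L t b p" .
      qed
    qed
    then show ?thesis unfolding is_expansion_mod_def J_iff by simp
  qed
  define cf where "cf t p q = (if q \<in> ?M then
      (\<Sum>b\<in>B. N t (inv_into UNIV monomial q) b * L t b p) * inverse (D t) else 0)" for t p and q :: "('n, 'k) mpoly"
  have exp: "is_expansion_mod (?J t) ?M p c \<longleftrightarrow> c = cf t p" if "D t \<noteq> 0" for t p c
    unfolding exp_iff[OF that] by (auto simp: cf_def inv_f_f[OF inj_monomial] fun_eq_iff)
  have basis_t: "is_basis_mod (?J t) ?M" if "D t \<noteq> 0" for t
    using M(1) exp[OF that] by (auto simp: is_basis_mod_def)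
  define coord where "coord t = (\<lambda>(m', m). if m \<in> M then
      (\<Sum>b\<in>B. N t m b * L t b (monomial m')) * inverse (D t) else 0)" for t
  have coord: "chart_coord M (?J t) = coord t" if "D t \<noteq> 0" for t
    unfolding chart_coord_def coeff_mod_def exp[OF that] the_eq_trivial coord_def
    by (auto simp: fun_eq_iff cf_def mem_M inv_f_f[OF inj_monomial])
  let ?C = "insert (\<lambda>t. inverse (D t)) C"
  have up: "f \<in> polyfuns C \<Longrightarrow> f \<in> polyfuns ?C" for f
    using polyfuns_compose[of f C "\<lambda>t. t" ?C] by (auto intro: polyfuns.gen)
  have inv: "(\<lambda>t. inverse (D t)) \<in> polyfuns ?C"
    by (rule polyfuns.gen) simp
  have cp: "(\<lambda>t. coord t v) \<in> polyfuns ?C" for v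
  proof (cases v)
    case (Pair m' m)
    show ?thesis
    proof (cases "m \<in> M")
      case True
      then show ?thesis unfolding coord_def Pair
        by (simp, intro polyfuns.mult[OF _ inv] polyfuns_sum) (auto intro!: polyfuns.mult intro: up N poly)
    qed (simp add: coord_def Pair polyfuns.const)
  qed
  have "(\<lambda>t. eval (coord t) F) \<in> polyfuns ?C"
    unfolding subst_def by (intro polyfuns_intros cp)
  from polyfuns_clear_denominators[OF D(1) this] obtain K P where
    P: "P \<in> polyfuns C" "\<And>t. D t \<noteq> 0 \<Longrightarrow> eval (coord t) F * D t ^ K = P t" by blast
  have ind: "independent_on (L t) B" if Dt: "D t \<noteq> 0" for t
    unfolding independent_on_def
  proof (intro allI impI ballI)
    fix c b' assume c: "\<forall>f. (\<Sum>b\<in>B. c b * L t b f) = 0" and b': "b' \<in> B"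
    have "0 = (\<Sum>m\<in>M. (\<Sum>b\<in>B. c b * L t b (monomial m)) * N t m b')" using c by simp
    also have "\<dots> = (\<Sum>b\<in>B. c b * (\<Sum>m\<in>M. L t b (monomial m) * N t m b'))"
      unfolding sum_distrib_right sum_distrib_left by (subst sum.swap) (simp add: mult.assoc)
    also have "\<dots> = (\<Sum>b\<in>B. if b = b' then c b * D t else 0)"
      by (intro sum.cong refl) (simp add: AN b')
    also have "\<dots> = c b' * D t" using b' B by simp
    finally show "c b' = 0" using Dt by simp
  qed
  have "?J t \<in> principal_open M F" if "D t \<noteq> 0" "P t \<noteq> 0" "poly_ideal.subspace (?J t)" for t
  proof -
    have "card ?M = card M" by (rule card_image[OF injM])
    then have "?J t \<in> hilb_chart M"
      unfolding hilb_chart_def hilb_def using basis_t[OF that(1)] that(3) by blast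
    moreover have "eval (coord t) F \<noteq> 0" using P(2)[OF that(1)] that(2) by auto
    ultimately show ?thesis by (simp add: principal_open_def coord[OF that(1)])
  qed
  moreover have "P t0 \<noteq> 0" using nz P(2)[OF D(2)] D(2) by (auto simp: coord[OF D(2)])
  ultimately show ?thesis
    using P(1) D ind by (intro exI[of _ "\<lambda>t. P t * D t"]) (auto intro: polyfuns.mult)
qed

text \<open>The principal case passes through the generation of the topology: intersections multiply
  the functions \<open>G\<close>, and for a union the function of one member containing the ideal at
  \<open>t0\<close> serves.\<close>

lemma hilb_open_polyfuns:
  fixes L :: "'t \<Rightarrow> 'b \<Rightarrow> ('n::finite, 'k::field) mpoly \<Rightarrow> 'k"
  assumes lin: "\<And>t b. linear_functional (L t b)"
    and poly: "\<And>b m. b \<in> B \<Longrightarrow> (\<lambda>t. L t b (monomial m)) \<in> polyfuns C"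
    and B: "finite B" and U: "openin (hilb_topology (card B)) U"
    and t0: "common_zeros (L t0) B \<in> U"
  shows "\<exists>G. G \<in> polyfuns C \<and> G t0 \<noteq> 0 \<and> (\<forall>t. G t \<noteq> 0 \<longrightarrow> independent_on (L t) B \<and>
    (poly_ideal.subspace (common_zeros (L t) B) \<longrightarrow> common_zeros (L t) B \<in> U))"
  using U[unfolded hilb_topology_def openin_topology_generated_by_iff] t0
proof (induction U rule: generate_topology_on.induct)
  case Empty
  then show ?case by simp
next
  case (Int U V)
  then obtain G H where G: "G \<in> polyfuns C" "G t0 \<noteq> 0" "\<And>t. G t \<noteq> 0 \<Longrightarrow> independent_on (L t) B \<and>
        (poly_ideal.subspace (common_zeros (L t) B) \<longrightarrow> common_zeros (L t) B \<in> U)"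
      and H: "H \<in> polyfuns C" "H t0 \<noteq> 0" "\<And>t. H t \<noteq> 0 \<Longrightarrow> independent_on (L t) B \<and>
        (poly_ideal.subspace (common_zeros (L t) B) \<longrightarrow> common_zeros (L t) B \<in> V)"
    by blast
  then show ?case by (intro exI[of _ "\<lambda>t. G t * H t"]) (auto intro: polyfuns.mult)
next
  case (UN K)
  then obtain V where "V \<in> K" "common_zeros (L t0) B \<in> V" by blast
  with UN.IH obtain G where "G \<in> polyfuns C" "G t0 \<noteq> 0" "\<And>t. G t \<noteq> 0 \<Longrightarrow> independent_on (L t) B \<and>
      (poly_ideal.subspace (common_zeros (L t) B) \<longrightarrow> common_zeros (L t) B \<in> V)"
    by blast
  with \<open>V \<in> K\<close> show ?case by blast
next
  case (Basis U)
  then obtain M F where U: "U = principal_open M F" and M: "finite M" "card M = card B" by blast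
  show ?case
    unfolding U by (rule principal_open_polyfuns[OF lin poly B M Basis.prems[unfolded U]])
qed

section \<open>Degrees of exponent vectors\<close>

definition mdeg :: "('v \<Rightarrow>\<^sub>0 nat) \<Rightarrow> nat"
  where "mdeg m = (\<Sum>v\<in>Poly_Mapping.keys m. Poly_Mapping.lookup m v)"

lemma mdeg_UNIV: "mdeg m = (\<Sum>v\<in>UNIV. Poly_Mapping.lookup m v)"
  for m :: "'v::finite \<Rightarrow>\<^sub>0 nat"
  unfolding mdeg_def by (rule sum.mono_neutral_left) (auto simp: in_keys_iff)

lemma mdeg_add: "mdeg (m + n) = mdeg m + mdeg n"
  for m :: "'v::finite \<Rightarrow>\<^sub>0 nat"
  by (simp add: mdeg_UNIV lookup_add sum.distrib)

lemma mdeg_eq_0_iff [simp]: "mdeg m = 0 \<longleftrightarrow> m = 0"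
  by (auto simp: mdeg_def in_keys_iff) (metis keys_eq_empty ex_in_conv in_keys_iff)

lemma mdeg_0 [simp]: "mdeg 0 = 0"
  by simp

lemma mdeg_single [simp]: "mdeg (Poly_Mapping.single v n) = n"
  by (simp add: mdeg_def)

lemma mdeg_SucE:
  assumes "mdeg m = Suc d"
  obtains v m' where "m = Poly_Mapping.single v 1 + m'" "mdeg m' = d"
proof -
  have "m \<noteq> 0" using assms by auto
  then obtain v where v: "Poly_Mapping.lookup m v \<noteq> 0"
    by (metis poly_mapping_eqI lookup_zero)
  define m' where "m' = m - Poly_Mapping.single v 1"
  have m: "m = Poly_Mapping.single v 1 + m'"
    by (rule poly_mapping_eqI) (use v in \<open>auto simp: m'_def lookup_add lookup_minus lookup_single when_def\<close>)
  have "mdeg m = (\<Sum>w\<in>insert v (Poly_Mapping.keys m'). Poly_Mapping.lookup m w)"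
    unfolding mdeg_def
    by (rule sum.mono_neutral_left) (use m in \<open>auto simp: in_keys_iff lookup_add lookup_single when_def split: if_splits\<close>)
  also have "\<dots> = (\<Sum>w\<in>insert v (Poly_Mapping.keys m'). (if w = v then 1 else 0) + Poly_Mapping.lookup m' w)"
    by (rule sum.cong) (auto simp: m lookup_add lookup_single when_def)
  also have "\<dots> = 1 + (\<Sum>w\<in>insert v (Poly_Mapping.keys m'). Poly_Mapping.lookup m' w)"
    by (simp add: sum.distrib)
  also have "(\<Sum>w\<in>insert v (Poly_Mapping.keys m'). Poly_Mapping.lookup m' w) = mdeg m'"
    unfolding mdeg_def by (rule sum.mono_neutral_right) (auto simp: in_keys_iff)
  finally show thesis using that m assms by simp
qed

lemma mdeg_1E:
  assumes "mdeg m = 1"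
  obtains v where "m = Poly_Mapping.single v 1"
  using assms mdeg_SucE[of m 0] by auto

lemma mdeg_2E:
  assumes "mdeg m = 2"
  obtains a b where "m = Poly_Mapping.single a 1 + Poly_Mapping.single b 1"
  using assms mdeg_SucE[of m 1] mdeg_1E by (metis Suc_1 One_nat_def)

lemma mdeg_ge3E:
  assumes "mdeg m \<ge> 3"
  obtains a b c m' where "m = Poly_Mapping.single a 1 + (Poly_Mapping.single b 1 + (Poly_Mapping.single c 1 + m'))"
proof -
  have "mdeg m = Suc (Suc (Suc (mdeg m - 3)))" using assms by linarith
  then obtain a n where "m = Poly_Mapping.single a 1 + n" "mdeg n = Suc (Suc (mdeg m - 3))"
    by (rule mdeg_SucE)
  moreover from this(2) obtain b n' where "n = Poly_Mapping.single b 1 + n'" "mdeg n' = Suc (mdeg m - 3)"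
    by (rule mdeg_SucE)
  moreover from this(2) obtain c m' where "n' = Poly_Mapping.single c 1 + m'"
    by (rule mdeg_SucE)
  ultimately show thesis using that by blast
qed

lemma power_vec_scale: "power_vec (\<lambda>v. s * x v) m = s ^ mdeg m * power_vec x m"
  for s :: "'b::comm_semiring_1"
  by (simp add: power_vec_def mdeg_def power_mult_distrib prod.distrib power_sum)

lemma power_vec_0: "power_vec (\<lambda>_. 0 :: 'b::comm_semiring_1) m = (if m = 0 then 1 else 0)"
  using power_vec_scale[of "0::'b" "\<lambda>_. 0" m] by (auto simp: power_0_left)

text \<open>Values on the monomials may be prescribed freely, without finiteness, so every linear
  functional on the polynomial ring has this form; evaluations and dual quadrics are treated
  uniformly.\<close>

definition coeff_functional :: "(('v \<Rightarrow>\<^sub>0 nat) \<Rightarrow> 'k) \<Rightarrow> ('v, 'k::field) mpoly \<Rightarrow> 'k"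
  where "coeff_functional c f = (\<Sum>m\<in>Poly_Mapping.keys f. Poly_Mapping.lookup f m * c m)"

lemma coeff_functional_eq_sum:
  "finite S \<Longrightarrow> Poly_Mapping.keys f \<subseteq> S \<Longrightarrow>
    coeff_functional c f = (\<Sum>m\<in>S. Poly_Mapping.lookup f m * c m)"
  unfolding coeff_functional_def by (rule sum.mono_neutral_left) (auto simp: in_keys_iff)

lemma linear_functional_coeff_functional: "linear_functional (coeff_functional c)"
proof (rule linear_functionalI)
  fix p q :: "('a, 'b) mpoly" and a
  let ?S = "Poly_Mapping.keys p \<union> Poly_Mapping.keys q"
  have "Poly_Mapping.keys (p + q) \<subseteq> ?S" by (rule keys_add)
  then show "coeff_functional c (p + q) = coeff_functional c p + coeff_functional c q"
    by (simp add: coeff_functional_eq_sum[of ?S] lookup_add distrib_right sum.distrib)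
  have "Poly_Mapping.keys (scale a p) \<subseteq> Poly_Mapping.keys p" by (auto simp: in_keys_iff)
  then show "coeff_functional c (scale a p) = a * coeff_functional c p"
    by (simp add: coeff_functional_eq_sum[of "Poly_Mapping.keys p"] sum_distrib_left mult.assoc)
qed

lemma coeff_functional_monomial [simp]: "coeff_functional c (monomial m) = c m"
  by (simp add: coeff_functional_def monomial_def)

lemma coeff_functional_add: "coeff_functional (\<lambda>m. c m + c' m) f = coeff_functional c f + coeff_functional c' f"
  by (simp add: coeff_functional_def distrib_left sum.distrib)

lemma coeff_functional_mult: "coeff_functional (\<lambda>m. a * c m) f = a * coeff_functional c f"
  by (simp add: coeff_functional_def sum_distrib_left mult_ac)

lemma coeff_functional_sum: "coeff_functional (\<lambda>m. \<Sum>i\<in>A. c i m) f = (\<Sum>i\<in>A. coeff_functional (c i) f)"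
  unfolding coeff_functional_def sum_distrib_left by (rule sum.swap)

lemma coeff_functional_cong:
  "(\<And>m. m \<in> Poly_Mapping.keys f \<Longrightarrow> c m = c' m) \<Longrightarrow> coeff_functional c f = coeff_functional c' f"
  by (simp add: coeff_functional_def)

lemma coeff_functional_single:
  "coeff_functional (\<lambda>m. if m = m0 then x else 0) f = Poly_Mapping.lookup f m0 * x"
proof -
  have "coeff_functional (\<lambda>m. if m = m0 then x else 0) f
      = (\<Sum>m\<in>Poly_Mapping.keys f. if m = m0 then Poly_Mapping.lookup f m0 * x else 0)"
    unfolding coeff_functional_def by (rule sum.cong) auto
  then show ?thesis by (simp add: in_keys_iff)
qed

lemma coeff_functional_power_vec: "coeff_functional (power_vec x) f = eval x f"
  by (simp add: coeff_functional_def subst_def power_vec_def)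

section \<open>Translations, vanishing ideals and the index set of a configuration\<close>

definition shift :: "('n \<Rightarrow> 'k::field) \<Rightarrow> ('n, 'k) mpoly \<Rightarrow> ('n, 'k) mpoly"
  where "shift a = subst Const (\<lambda>i. Var i + Const (a i))"

lemma translate_shift: "translate a I = {f. shift a f \<in> I}"
  by (simp add: translate_def shift_def)

lemma eval_shift: "eval x (shift a f) = eval (\<lambda>i. x i + a i) f"
  for x :: "'n::finite \<Rightarrow> 'k::field"
  unfolding shift_def eval_subst by (simp add: eval_add Var_def)

lemma linear_functional_shift: "linear_functional L \<Longrightarrow> linear_functional (\<lambda>p. L (shift a p))"
  for L :: "('n::finite, 'k::field) mpoly \<Rightarrow> 'k"
  unfolding shift_def by (rule linear_functional_subst)

lemma subspace_translate:
  fixes I :: "('n::finite, 'k::field) mpoly set"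
  assumes I: "poly_ideal.subspace I"
  shows "poly_ideal.subspace (translate a I)"
proof (rule poly_ideal.subspaceI)
  show "0 \<in> translate a I"
    using poly_ideal.subspace_0[OF I] by (simp add: translate_def subst_def)
  show "p + q \<in> translate a I" if "p \<in> translate a I" "q \<in> translate a I" for p q
    using that poly_ideal.subspace_add[OF I] by (simp add: translate_def subst_Const_add)
  show "c * p \<in> translate a I" if "p \<in> translate a I" for c p
    using that poly_ideal.subspace_scale[OF I]
    by (simp add: translate_def subst_mult Const_add Const_mult)
qed

lemma subspace_vanishing_ideal:
  "poly_ideal.subspace (vanishing_ideal P :: ('n::finite, 'k::field) mpoly set)"
  by (rule poly_ideal.subspaceI) (auto simp: vanishing_ideal_def eval_add eval_mult)

text \<open>Labels are used instead of the points themselves: at \<open>s = 0\<close> all points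
  collapse to the origin, while the functionals carrying the same labels can remain
  independent.\<close>

datatype 'n node = Origin | Axis 'n | Extra nat

definition nodes :: "nat \<Rightarrow> 'n node set"
  where "nodes r = insert Origin (range Axis \<union> Extra ` {..<r})"

lemma finite_nodes [simp]: "finite (nodes r :: 'n::finite node set)"
  by (simp add: nodes_def)

lemma sum_nodes:
  "(\<Sum>b\<in>(nodes r :: 'n::finite node set). F b) = F Origin + ((\<Sum>i\<in>UNIV. F (Axis i)) + (\<Sum>j<r. F (Extra j)))"
  for F :: "_ \<Rightarrow> 'a::comm_monoid_add"
proof -
  have "(\<Sum>b\<in>(nodes r :: 'n node set). F b) = F Origin + (\<Sum>b\<in>range Axis \<union> Extra ` {..<r}. F b)"
    unfolding nodes_def by (rule sum.insert) auto
  also have "(\<Sum>b\<in>range Axis \<union> Extra ` {..<r}. F b) = (\<Sum>b\<in>range Axis. F b) + (\<Sum>b\<in>Extra ` {..<r}. F b)"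
    by (rule sum.union_disjoint) auto
  finally show ?thesis by (simp add: sum.reindex inj_on_def)
qed

lemma card_nodes: "card (nodes r :: 'n::finite node set) = 1 + CARD('n) + r"
  using sum_nodes[of "\<lambda>_. 1::nat" r] by simp

lemma ball_nodes:
  "(\<forall>b\<in>nodes r. P b) \<longleftrightarrow> P Origin \<and> (\<forall>i. P (Axis i)) \<and> (\<forall>j<r. P (Extra j))"
  by (auto simp: nodes_def)

section \<open>One-step ideals and their dual quadrics\<close>

text \<open>The annihilator of the inverse system spanned by 1, the linear forms and the quadrics
  \<open>w j\<close>. Only values of \<open>w\<close> in degree 2 with \<open>j < r\<close> enter;
  \<open>w\<close> is nevertheless a function on all pairs, so that the parameter space is a plain
  function space.\<close>

definition dual_ideal :: "nat \<Rightarrow> (nat \<times> ('n \<Rightarrow>\<^sub>0 nat) \<Rightarrow> 'k) \<Rightarrow> ('n, 'k::field) mpoly set"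
  where "dual_ideal r w = {f. (\<forall>m\<in>Poly_Mapping.keys f. 2 \<le> mdeg m) \<and>
    (\<forall>j<r. coeff_functional (\<lambda>m. if mdeg m = 2 then w (j, m) else 0) f = 0)}"

fun dual_coeff :: "(nat \<times> ('n \<Rightarrow>\<^sub>0 nat) \<Rightarrow> 'k) \<Rightarrow> 'n node \<Rightarrow> ('n \<Rightarrow>\<^sub>0 nat) \<Rightarrow> 'k::field"
  where
    "dual_coeff w Origin = (\<lambda>m. if m = 0 then 1 else 0)"
  | "dual_coeff w (Axis i) = (\<lambda>m. if m = Poly_Mapping.single i 1 then 1 else 0)"
  | "dual_coeff w (Extra j) = (\<lambda>m. if mdeg m = 2 then w (j, m) else 0)"

lemma mdeg_ge_2_iff:
  "(\<forall>m\<in>Poly_Mapping.keys f. 2 \<le> mdeg m) \<longleftrightarrow>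
    Poly_Mapping.lookup f 0 = 0 \<and> (\<forall>i. Poly_Mapping.lookup f (Poly_Mapping.single i 1) = 0)"
proof -
  have "m = 0 \<or> (\<exists>i. m = Poly_Mapping.single i 1)" if "\<not> 2 \<le> mdeg m" for m :: "'a \<Rightarrow>\<^sub>0 nat"
  proof -
    have "mdeg m = 0 \<or> mdeg m = 1" using that by linarith
    then show ?thesis by (metis mdeg_1E mdeg_eq_0_iff)
  qed
  moreover have "\<not> 2 \<le> mdeg (Poly_Mapping.single i 1 :: 'a \<Rightarrow>\<^sub>0 nat)" for i :: 'a
    by simp
  moreover have "\<not> 2 \<le> mdeg (0 :: 'a \<Rightarrow>\<^sub>0 nat)"
    by simp
  ultimately show ?thesis by (metis in_keys_iff)
qed

lemma dual_ideal_common_zeros: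
  "dual_ideal r w = common_zeros (\<lambda>b. coeff_functional (dual_coeff w b)) (nodes r)"
  unfolding dual_ideal_def common_zeros_def mdeg_ge_2_iff ball_nodes
  by (simp add: coeff_functional_single)

text \<open>A nonconstant monomial carries elements of order at least 2 to order at least 3, where
  all the functionals vanish; constants are covered by linearity.\<close>

lemma subspace_dual_ideal:
  "poly_ideal.subspace (dual_ideal r w :: ('n::finite, 'k::field) mpoly set)"
proof (rule poly_ideal.subspaceI)
  show "0 \<in> (dual_ideal r w :: ('n, 'k) mpoly set)"
    by (simp add: dual_ideal_def coeff_functional_def)
  show add: "p + q \<in> dual_ideal r w" if "p \<in> dual_ideal r w" "q \<in> dual_ideal r w"
    for p q :: "('n, 'k) mpoly"
    using that unfolding dual_ideal_common_zeros common_zeros_def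
    by (simp add: linear_functional_add[OF linear_functional_coeff_functional])
  show "c * p \<in> dual_ideal r w" if p: "p \<in> dual_ideal r w" for c p :: "('n, 'k) mpoly"
  proof -
    have "Poly_Mapping.single m x * p \<in> dual_ideal r w" for m x
    proof (cases "m = 0")
      case True
      then have "Poly_Mapping.single m x * p = scale x p" by (simp add: scale_def Const_def)
      then show ?thesis using p unfolding dual_ideal_common_zeros common_zeros_def
        by (simp add: linear_functional_scale[OF linear_functional_coeff_functional])
    next
      case False
      then have "1 \<le> mdeg m" by (metis mdeg_eq_0_iff less_one not_less)
      moreover have "2 \<le> mdeg n" if "n \<in> Poly_Mapping.keys p" for n
        using p that by (auto simp: dual_ideal_def)
      moreover have "Poly_Mapping.keys (Poly_Mapping.single m x * p) \<subseteq> {m + n |n. n \<in> Poly_Mapping.keys p}"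
        using keys_mult[of "Poly_Mapping.single m x" p] by (auto split: if_splits)
      ultimately have deg: "3 \<le> mdeg n" if "n \<in> Poly_Mapping.keys (Poly_Mapping.single m x * p)" for n
        using that by (force simp: mdeg_add)
      then have "coeff_functional (\<lambda>m. if mdeg m = 2 then w (j, m) else 0) (Poly_Mapping.single m x * p)
          = coeff_functional (\<lambda>_. 0) (Poly_Mapping.single m x * p)" for j
        by (intro coeff_functional_cong) force
      with deg show ?thesis by (force simp: dual_ideal_def coeff_functional_def)
    qed
    then have "(\<Sum>m\<in>A. Poly_Mapping.single m (x m) * p) \<in> dual_ideal r w" for A x
      by (induction A rule: infinite_finite_induct)
        (simp_all add: add, simp_all add: dual_ideal_def coeff_functional_def)
    then show ?thesis
      by (subst poly_eq_sum_monomials[of c]) (simp add: scale_monomial sum_distrib_right)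
  qed
qed

section \<open>Quadratic parts and the structure of one-step ideals\<close>

definition quad_part :: "('n, 'k::field) mpoly \<Rightarrow> ('n, 'k) mpoly"
  where "quad_part f =
    (\<Sum>m\<in>{m \<in> Poly_Mapping.keys f. mdeg m = 2}. Poly_Mapping.single m (Poly_Mapping.lookup f m))"

lemma lookup_quad_part:
  "Poly_Mapping.lookup (quad_part f) m = (if mdeg m = 2 then Poly_Mapping.lookup f m else 0)"
  by (auto simp: quad_part_def lookup_sum lookup_single when_def in_keys_iff)

lemma quadratic_forms_iff: "q \<in> quadratic_forms \<longleftrightarrow> (\<forall>m\<in>Poly_Mapping.keys q. mdeg m = 2)"
  by (simp add: quadratic_forms_def mdeg_def)

lemma quad_part_quadratic: "quad_part f \<in> quadratic_forms"
  by (auto simp: quadratic_forms_iff in_keys_iff lookup_quad_part split: if_splits)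

lemma quad_part_id: "q \<in> quadratic_forms \<Longrightarrow> quad_part q = q"
  by (rule poly_mapping_eqI) (auto simp: quadratic_forms_iff in_keys_iff lookup_quad_part)

lemma coeff_functional_quad_part:
  "coeff_functional (\<lambda>m. if mdeg m = 2 then c m else 0) f = coeff_functional c (quad_part f)"
proof -
  have "Poly_Mapping.keys (quad_part f) \<subseteq> Poly_Mapping.keys f"
    by (auto simp: in_keys_iff lookup_quad_part split: if_splits)
  then have "coeff_functional c (quad_part f)
      = (\<Sum>m\<in>Poly_Mapping.keys f. Poly_Mapping.lookup (quad_part f) m * c m)"
    by (intro coeff_functional_eq_sum) auto
  then show ?thesis
    unfolding coeff_functional_def by (simp add: lookup_quad_part if_distrib cong: if_cong)
      (intro sum.cong; simp)
qed


lemma keys_mult_ge: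
  fixes p q :: "('n::finite, 'k::field) mpoly"
  assumes "\<forall>m\<in>Poly_Mapping.keys p. d \<le> mdeg m" "\<forall>m\<in>Poly_Mapping.keys q. e \<le> mdeg m"
  shows "\<forall>m\<in>Poly_Mapping.keys (p * q). d + e \<le> mdeg m"
proof
  fix m assume "m \<in> Poly_Mapping.keys (p * q)"
  then obtain m1 m2 where "m1 \<in> Poly_Mapping.keys p" "m2 \<in> Poly_Mapping.keys q" "m = m1 + m2"
    using keys_mult[of p q] by blast
  then show "d + e \<le> mdeg m" using assms by (simp add: mdeg_add add_mono)
qed

lemma subspace_order_ge:
  "poly_ideal.subspace {f :: ('n::finite, 'k::field) mpoly. \<forall>m\<in>Poly_Mapping.keys f. d \<le> mdeg m}"
proof (rule poly_ideal.subspaceI)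
  fix p q :: "('n, 'k) mpoly"
  assume "p \<in> {f. \<forall>m\<in>Poly_Mapping.keys f. d \<le> mdeg m}" "q \<in> {f. \<forall>m\<in>Poly_Mapping.keys f. d \<le> mdeg m}"
  then show "p + q \<in> {f. \<forall>m\<in>Poly_Mapping.keys f. d \<le> mdeg m}"
    using keys_add[of p q] by blast
next
  fix c p :: "('n, 'k) mpoly"
  assume "p \<in> {f. \<forall>m\<in>Poly_Mapping.keys f. d \<le> mdeg m}"
  then show "c * p \<in> {f. \<forall>m\<in>Poly_Mapping.keys f. d \<le> mdeg m}"
    using keys_mult_ge[of c 0 p d] by simp
qed simp

lemma max_ideal_order: "f \<in> max_ideal \<Longrightarrow> \<forall>m\<in>Poly_Mapping.keys f. 1 \<le> mdeg m"
  for f :: "('n::finite, 'k::field) mpoly"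
proof -
  have "max_ideal \<subseteq> {f :: ('n, 'k) mpoly. \<forall>m\<in>Poly_Mapping.keys f. 1 \<le> mdeg m}"
    unfolding max_ideal_def
    by (rule poly_ideal.span_minimal[OF _ subspace_order_ge]) (auto simp: Var_def monomial_def)
  then show "f \<in> max_ideal \<Longrightarrow> \<forall>m\<in>Poly_Mapping.keys f. 1 \<le> mdeg m" by blast
qed

lemma max_ideal_cubed_eq:
  "max_ideal_cubed = {f :: ('n::finite, 'k::field) mpoly. \<forall>m\<in>Poly_Mapping.keys f. 3 \<le> mdeg m}"
proof
  show "max_ideal_cubed \<subseteq> {f :: ('n, 'k) mpoly. \<forall>m\<in>Poly_Mapping.keys f. 3 \<le> mdeg m}"
    unfolding max_ideal_cubed_def
  proof (rule poly_ideal.span_minimal[OF _ subspace_order_ge], clarify)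
    fix f g h :: "('n, 'k) mpoly" and m
    assume "f \<in> max_ideal" "g \<in> max_ideal" "h \<in> max_ideal" "m \<in> Poly_Mapping.keys (f * g * h)"
    then show "3 \<le> mdeg m"
      using keys_mult_ge[OF keys_mult_ge[OF max_ideal_order max_ideal_order] max_ideal_order, of f g h]
      by auto
  qed
  show "{f :: ('n, 'k) mpoly. \<forall>m\<in>Poly_Mapping.keys f. 3 \<le> mdeg m} \<subseteq> max_ideal_cubed"
  proof
    fix f :: "('n, 'k) mpoly"
    assume "f \<in> {f. \<forall>m\<in>Poly_Mapping.keys f. 3 \<le> mdeg m}"
    then have f: "3 \<le> mdeg m" if "m \<in> Poly_Mapping.keys f" for m using that by blast
    have sub: "poly_ideal.subspace (max_ideal_cubed :: ('n, 'k) mpoly set)"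
      unfolding max_ideal_cubed_def by (rule poly_ideal.subspace_span)
    have Var: "(Var i :: ('n, 'k) mpoly) \<in> max_ideal" for i
      unfolding max_ideal_def by (rule poly_ideal.span_base) simp
    have "monomial m \<in> (max_ideal_cubed :: ('n, 'k) mpoly set)" if m: "m \<in> Poly_Mapping.keys f" for m
    proof -
      obtain a b c m' where "m = Poly_Mapping.single a 1 + (Poly_Mapping.single b 1 + (Poly_Mapping.single c 1 + m'))"
        by (rule mdeg_ge3E[OF f[OF m]])
      then have eq: "(monomial m :: ('n, 'k) mpoly) = monomial m' * (Var a * Var b * Var c)"
        by (simp add: Var_def monomial_def mult_single add_ac)
      have "(Var a * Var b * Var c :: ('n, 'k) mpoly) \<in> max_ideal_cubed"
        unfolding max_ideal_cubed_def by (rule poly_ideal.span_base) (use Var in blast)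
      then show ?thesis unfolding eq by (rule poly_ideal.subspace_scale[OF sub])
    qed
    then show "f \<in> max_ideal_cubed"
      by (subst poly_eq_sum_monomials) (intro poly_ideal.subspace_sum[OF sub] ideal_scale[OF sub])
  qed
qed

lemma one_step_ideal_eq:
  fixes Q :: "('n::finite, 'k::field) mpoly set"
  assumes Q: "poly_vs.subspace Q" "Q \<subseteq> quadratic_forms"
  shows "one_step_ideal Q = {f. (\<forall>m\<in>Poly_Mapping.keys f. 2 \<le> mdeg m) \<and> quad_part f \<in> Q}"
    (is "_ = ?A")
proof
  have quad_add: "quad_part (f + g) = quad_part f + quad_part g" for f g :: "('n, 'k) mpoly"
    by (rule poly_mapping_eqI) (simp add: lookup_quad_part lookup_add)
  have A: "poly_ideal.subspace ?A"
  proof (rule poly_ideal.subspaceI)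
    show "0 \<in> ?A" using poly_vs.subspace_0[OF Q(1)] by (simp add: quad_part_def)
    show "f + g \<in> ?A" if "f \<in> ?A" "g \<in> ?A" for f g
      using that keys_add[of f g] poly_vs.subspace_add[OF Q(1)] by (force simp: quad_add)
    show "c * f \<in> ?A" if f: "f \<in> ?A" for c f
    proof -
      \<comment> \<open>The constant term of \<open>c\<close> acts as a scalar; the rest has order
        at least 1 and pushes \<open>f\<close> into order at least 3, so it contributes nothing to
        the quadratic part.\<close>
      define c' where "c' = c - Const (Poly_Mapping.lookup c 0)"
      have c: "c * f = scale (Poly_Mapping.lookup c 0) f + c' * f"
        by (simp add: c'_def scale_def algebra_simps)
      have "\<forall>m\<in>Poly_Mapping.keys c'. 1 \<le> mdeg m"
        by (auto simp: c'_def in_keys_iff lookup_minus Const_def lookup_single when_def Suc_le_eq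
            split: if_splits) (metis mdeg_eq_0_iff neq0_conv)
      then have "\<forall>m\<in>Poly_Mapping.keys (c' * f). 3 \<le> mdeg m"
        using keys_mult_ge[of c' 1 f 2] f by (simp add: numeral_3_eq_3)
      then have "quad_part (c' * f) = 0"
        by (intro poly_mapping_eqI) (force simp: lookup_quad_part in_keys_iff)
      moreover have "quad_part (scale x f) = scale x (quad_part f)" for x
        by (rule poly_mapping_eqI) (simp add: lookup_quad_part)
      ultimately have "quad_part (c * f) \<in> Q"
        using f poly_vs.subspace_scale[OF Q(1)] by (simp add: c quad_add)
      moreover have "\<forall>m\<in>Poly_Mapping.keys (c * f). 2 \<le> mdeg m"
        using keys_mult_ge[of c 0 f 2] f by (simp add: numeral_2_eq_2)
      ultimately show ?thesis by simp
    qed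
  qed
  have "Q \<subseteq> ?A"
  proof
    fix q assume q: "q \<in> Q"
    then have "q \<in> quadratic_forms" using Q(2) by blast
    then show "q \<in> ?A" using q by (simp add: quad_part_id) (simp add: quadratic_forms_iff)
  qed
  then have "poly_ideal.span Q \<subseteq> ?A" by (rule poly_ideal.span_minimal[OF _ A])
  moreover have "max_ideal_cubed \<subseteq> ?A"
  proof
    fix f :: "('n, 'k) mpoly" assume "f \<in> max_ideal_cubed"
    then have f: "\<forall>m\<in>Poly_Mapping.keys f. 3 \<le> mdeg m" by (simp add: max_ideal_cubed_eq)
    then have "quad_part f = 0"
      by (intro poly_mapping_eqI) (force simp: lookup_quad_part in_keys_iff)
    then show "f \<in> ?A" using f poly_vs.subspace_0[OF Q(1)] by force
  qed
  ultimately show "one_step_ideal Q \<subseteq> ?A"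
    unfolding one_step_ideal_def using poly_ideal.subspace_add[OF A] by blast
  show "?A \<subseteq> one_step_ideal Q"
  proof
    fix f assume f: "f \<in> ?A"
    have "f - quad_part f \<in> max_ideal_cubed"
      unfolding max_ideal_cubed_eq
    proof (clarify)
      fix m assume "m \<in> Poly_Mapping.keys (f - quad_part f)"
      then have "Poly_Mapping.lookup f m \<noteq> 0" "mdeg m \<noteq> 2"
        by (auto simp: in_keys_iff lookup_minus lookup_quad_part split: if_splits)
      then show "3 \<le> mdeg m" using f by (force simp: in_keys_iff)
    qed
    moreover have "quad_part f \<in> poly_ideal.span Q" using f by (intro poly_ideal.span_base) simp
    moreover have "f = quad_part f + (f - quad_part f)" by simp
    ultimately show "f \<in> one_step_ideal Q" unfolding one_step_ideal_def by blast
  qed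
qed

text \<open>Serves to show that independent sets of quadratic forms are finite.\<close>

lemma quadratic_forms_span:
  "quadratic_forms \<subseteq> poly_vs.span (monomial ` (\<lambda>(a, b). Poly_Mapping.single a 1 + Poly_Mapping.single b 1) ` UNIV)"
proof
  fix q :: "('n, 'k::field) mpoly" assume q: "q \<in> quadratic_forms"
  have "m \<in> (\<lambda>(a, b). Poly_Mapping.single a 1 + Poly_Mapping.single b 1) ` UNIV"
    if "m \<in> Poly_Mapping.keys q" for m
  proof -
    have "mdeg m = 2" using q that by (simp add: quadratic_forms_iff)
    then obtain a b where "m = Poly_Mapping.single a 1 + Poly_Mapping.single b 1"
      by (rule mdeg_2E)
    then show ?thesis by (intro image_eqI[of _ _ "(a, b)"]) simp_all
  qed
  then show "q \<in> poly_vs.span (monomial ` (\<lambda>(a, b). Poly_Mapping.single a 1 + Poly_Mapping.single b 1) ` UNIV)"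
    by (subst poly_eq_sum_monomials) (intro poly_vs.span_sum poly_vs.span_scale poly_vs.span_base imageI)
qed

lemma subspace_quadratic_forms: "poly_vs.subspace (quadratic_forms :: ('n, 'k::field) mpoly set)"
proof (rule poly_vs.subspaceI)
  fix p q :: "('n, 'k) mpoly" and c
  assume p: "p \<in> quadratic_forms"
  then show "scale c p \<in> quadratic_forms" by (auto simp: quadratic_forms_iff in_keys_iff)
  assume "q \<in> quadratic_forms"
  with p show "p + q \<in> quadratic_forms" using keys_add[of p q] by (auto simp: quadratic_forms_iff)
qed (simp add: quadratic_forms_iff)

text \<open>Extend a basis of \<open>Q\<close> to a basis of all quadratic forms: the coordinates of
  the \<open>r\<close> added basis elements cut out \<open>Q\<close>, and their values on monomials
  are \<open>w\<close>.\<close>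

lemma codim_subspace_as_zeros:
  fixes Q :: "('n::finite, 'k::field) mpoly set"
  assumes Q: "poly_vs.subspace Q" "Q \<subseteq> quadratic_forms"
    and dim: "poly_vs.dim Q + r = poly_vs.dim (quadratic_forms :: ('n, 'k) mpoly set)"
  obtains w where "Q = {q \<in> quadratic_forms. \<forall>j<r. coeff_functional (\<lambda>m. w (j, m)) q = 0}"
proof -
  let ?S = "quadratic_forms :: ('n, 'k) mpoly set"
  obtain B where B: "B \<subseteq> Q" "poly_vs.independent B" "Q \<subseteq> poly_vs.span B" "card B = poly_vs.dim Q"
    using poly_vs.basis_exists by blast
  have spanB: "poly_vs.span B = Q" using B(1,3) Q(1) by (simp add: poly_vs.span_subspace)
  have BS: "B \<subseteq> ?S" using B(1) Q(2) by (rule subset_trans)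
  obtain C where C: "B \<subseteq> C" "C \<subseteq> ?S" "poly_vs.independent C" "?S \<subseteq> poly_vs.span C"
    by (rule poly_vs.maximal_independent_subset_extend[OF BS B(2)])
  have spanC: "poly_vs.span C = ?S"
    using C(2,4) subspace_quadratic_forms by (rule poly_vs.span_subspace)
  have "finite C"
    using poly_vs.independent_span_bound[OF _ C(3)] C(2) quadratic_forms_span by (meson finite finite_imageI subset_trans)
  have cardC: "card C = poly_vs.dim ?S"
    using C by (simp add: poly_vs.basis_card_eq_dim)
  have "card (C - B) = r"
    using card_Diff_subset[of B C] C(1) \<open>finite C\<close> cardC B(4) dim finite_subset[OF C(1)] by simp
  then obtain e where e: "bij_betw e {..<r} (C - B)"
    using ex_bij_betw_nat_finite[of "C - B"] \<open>finite C\<close> by (auto simp: atLeast0LessThan)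
  define w where "w = (\<lambda>(j, m). poly_vs.representation C (monomial m) (e j))"
  have rep: "coeff_functional (\<lambda>m. w (j, m)) q = poly_vs.representation C q (e j)" if "q \<in> ?S" for j q
  proof -
    have mon: "monomial m \<in> poly_vs.span C" if "m \<in> Poly_Mapping.keys q" for m
      unfolding spanC using that \<open>q \<in> ?S\<close> by (auto simp: quadratic_forms_iff monomial_def)
    have "poly_vs.representation C q = poly_vs.representation C
        (\<Sum>m\<in>Poly_Mapping.keys q. scale (Poly_Mapping.lookup q m) (monomial m))"
      by (simp flip: poly_eq_sum_monomials)
    also have "\<dots> = (\<lambda>b. \<Sum>m\<in>Poly_Mapping.keys q. poly_vs.representation C
        (scale (Poly_Mapping.lookup q m) (monomial m)) b)"
      using mon by (intro poly_vs.representation_sum[OF C(3)] poly_vs.span_scale) simp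
    finally show ?thesis
      using mon by (simp add: poly_vs.representation_scale[OF C(3)] coeff_functional_def w_def)
  qed
  have "Q = {q \<in> ?S. \<forall>j<r. poly_vs.representation C q (e j) = 0}"
  proof (intro equalityI subsetI)
    fix q assume q: "q \<in> Q"
    have "poly_vs.representation C q = poly_vs.representation B q"
      using poly_vs.representation_extend[OF C(3) _ C(1), of q] q spanB by simp
    moreover have "poly_vs.representation B q (e j) = 0" if "j < r" for j
      using poly_vs.representation_ne_zero[of B q "e j"] that e by (auto simp: bij_betw_def)
    ultimately show "q \<in> {q \<in> ?S. \<forall>j<r. poly_vs.representation C q (e j) = 0}"
      using q Q(2) by auto
  next
    fix q assume "q \<in> {q \<in> ?S. \<forall>j<r. poly_vs.representation C q (e j) = 0}"
    then have z: "poly_vs.representation C q (e j) = 0" if "j < r" for j using that by blast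
    have zero: "poly_vs.representation C q b = 0" if "b \<in> C - B" for b
    proof -
      have "b \<in> e ` {..<r}" using that e by (simp add: bij_betw_def)
      then show ?thesis using z by auto
    qed
    have qS: "q \<in> ?S" using \<open>q \<in> {q \<in> ?S. _}\<close> by simp
    have "q = (\<Sum>b\<in>C. scale (poly_vs.representation C q b) b)"
      using poly_vs.sum_representation_eq[OF C(3) _ \<open>finite C\<close> order_refl, of q] qS spanC by simp
    also have "\<dots> = (\<Sum>b\<in>B. scale (poly_vs.representation C q b) b)"
      using \<open>finite C\<close> C(1) zero by (intro sum.mono_neutral_right) auto
    also have "\<dots> \<in> poly_vs.span B"
      by (intro poly_vs.span_sum poly_vs.span_scale poly_vs.span_base)
    finally show "q \<in> Q" by (simp add: spanB)
  qed
  also have "\<dots> = {q \<in> ?S. \<forall>j<r. coeff_functional (\<lambda>m. w (j, m)) q = 0}"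
    using rep by auto
  finally show thesis by (rule that)
qed

lemma one_step_ideal_dual_ideal:
  fixes Q :: "('n::finite, 'k::field) mpoly set"
  assumes "poly_vs.subspace Q" "Q \<subseteq> quadratic_forms"
    and "poly_vs.dim Q + r = poly_vs.dim (quadratic_forms :: ('n, 'k) mpoly set)"
  obtains w where "one_step_ideal Q = dual_ideal r w"
proof -
  obtain w where w: "Q = {q \<in> quadratic_forms. \<forall>j<r. coeff_functional (\<lambda>m. w (j, m)) q = 0}"
    by (rule codim_subspace_as_zeros[OF assms])
  have "quad_part f \<in> Q \<longleftrightarrow> (\<forall>j<r. coeff_functional (\<lambda>m. if mdeg m = 2 then w (j, m) else 0) f = 0)" for f
    using quad_part_quadratic[of f] by (subst w) (simp add: coeff_functional_quad_part)
  then have "one_step_ideal Q = dual_ideal r w"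
    unfolding one_step_ideal_eq[OF assms(1,2)] dual_ideal_def by simp
  then show thesis by (rule that)
qed

section \<open>Degenerations of point configurations\<close>

text \<open>The coefficients of the functional taking \<open>f\<close> to its value at
  \<open>g v\<close> minus the combination, with weights \<open>v k\<close>, of its values at the
  columns of \<open>g\<close>; this combination kills linear forms. All degrees are kept since the
  same numbers occur in the divided differences for \<open>s \<noteq> 0\<close>. A commutative ring
  is allowed so that the entries can be polynomials in a curve parameter.\<close>

definition limit_dual ::
  "('n::finite \<Rightarrow> 'n \<Rightarrow> 'a) \<Rightarrow> (nat \<Rightarrow> 'n \<Rightarrow> 'a) \<Rightarrow> nat \<times> ('n \<Rightarrow>\<^sub>0 nat) \<Rightarrow> 'a::comm_ring_1"
  where "limit_dual g v = (\<lambda>(j, m). power_vec (\<lambda>a. \<Sum>k\<in>UNIV. g a k * v j k) m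
    - (\<Sum>k\<in>UNIV. v j k * power_vec (\<lambda>a. g a k) m))"

fun point :: "('n::finite \<Rightarrow> 'n \<Rightarrow> 'k) \<Rightarrow> (nat \<Rightarrow> 'n \<Rightarrow> 'k) \<Rightarrow> 'k::field \<Rightarrow> 'n node \<Rightarrow> 'n \<Rightarrow> 'k"
  where
    "point g v s Origin = (\<lambda>_. 0)"
  | "point g v s (Axis i) = (\<lambda>a. s * g a i)"
  | "point g v s (Extra j) = (\<lambda>a. s * (\<Sum>k\<in>UNIV. g a k * v j k))"

text \<open>
  Divided differences of the evaluations at the points: for \<open>s \<noteq> 0\<close> these functionals have the same
  common zeros as the evaluations, but they remain independent at \<open>s = 0\<close>. The truncated exponents
  only occur where the coefficient is \<open>0\<close>; in degree 1 the coefficient of an \<open>Extra\<close> node vanishes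
  by linearity (\<open>limit_dual_deg_1\<close>).
\<close>

fun config_coeff :: "('n::finite \<Rightarrow> 'n \<Rightarrow> 'k) \<Rightarrow> (nat \<Rightarrow> 'n \<Rightarrow> 'k) \<Rightarrow> 'k::field \<Rightarrow> 'n node \<Rightarrow> ('n \<Rightarrow>\<^sub>0 nat) \<Rightarrow> 'k"
  where
    "config_coeff g v s Origin = (\<lambda>m. if m = 0 then 1 else 0)"
  | "config_coeff g v s (Axis i) = (\<lambda>m. if mdeg m < 1 then 0 else s ^ (mdeg m - 1) * power_vec (\<lambda>a. g a i) m)"
  | "config_coeff g v s (Extra j) = (\<lambda>m. if mdeg m < 2 then 0 else s ^ (mdeg m - 2) * limit_dual g v (j, m))"

lemma limit_dual_deg_1: "mdeg m = 1 \<Longrightarrow> limit_dual g v (j, m) = 0"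
  by (erule mdeg_1E) (simp add: limit_dual_def mult.commute)

lemma config_coeff_polyfuns: "(\<lambda>s. config_coeff g v s b m) \<in> polyfuns1"
proof -
  have id: "(\<lambda>s. s) \<in> polyfuns1" by (rule polyfuns.gen) simp
  show ?thesis
    by (cases b; cases "mdeg m < 1"; cases "mdeg m < 2")
      (simp_all del: mdeg_eq_0_iff add: polyfuns.const polyfuns.mult polyfuns_power id)
qed

text \<open>A triangular change of functionals with diagonal entries 1, \<open>s\<close> and
  \<open>s^2\<close>, hence invertible exactly for \<open>s \<noteq> 0\<close>. On a monomial the
  scaling by \<open>s\<close> gives the factor \<open>s ^ mdeg m\<close>, from which one or two
  powers are split off; degrees 0 and 1 are the cases where fewer are available.\<close>

lemma eval_point:
  fixes g :: "'n::finite \<Rightarrow> 'n \<Rightarrow> 'k::field" and v :: "nat \<Rightarrow> 'n \<Rightarrow> 'k"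
  defines "K \<equiv> \<lambda>s b. coeff_functional (config_coeff g v s b)"
  shows "eval (point g v s Origin) f = K s Origin f"
    and "eval (point g v s (Axis i)) f = K s Origin f + s * K s (Axis i) f"
    and "eval (point g v s (Extra j)) f = K s Origin f
      + ((\<Sum>k\<in>UNIV. v j k * (s * K s (Axis k) f)) + s\<^sup>2 * K s (Extra j) f)"
proof -
  have O: "power_vec (point g v s Origin) m = config_coeff g v s Origin m" for m
    by (simp add: power_vec_0)
  have A: "power_vec (point g v s (Axis i)) m = config_coeff g v s Origin m + s * config_coeff g v s (Axis i) m" for i m
  proof (cases "m = 0")
    case False
    then obtain d where "mdeg m = Suc d" by (metis mdeg_eq_0_iff not0_implies_Suc)
    then show ?thesis using False by (simp add: power_vec_scale mult.assoc)
  qed simp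
  have E: "power_vec (point g v s (Extra j)) m = config_coeff g v s Origin m
      + ((\<Sum>k\<in>UNIV. v j k * (s * config_coeff g v s (Axis k) m)) + s\<^sup>2 * config_coeff g v s (Extra j) m)" for m
  proof -
    let ?l = "limit_dual g v (j, m)"
    have l: "power_vec (\<lambda>a. \<Sum>k\<in>UNIV. g a k * v j k) m = (\<Sum>k\<in>UNIV. v j k * power_vec (\<lambda>a. g a k) m) + ?l"
      by (simp add: limit_dual_def)
    have E: "power_vec (point g v s (Extra j)) m
        = s ^ mdeg m * ((\<Sum>k\<in>UNIV. v j k * power_vec (\<lambda>a. g a k) m) + ?l)"
      by (simp only: point.simps power_vec_scale l)
    consider "m = 0" | "mdeg m = 1" | d where "mdeg m = Suc (Suc d)"
      by (metis mdeg_eq_0_iff not0_implies_Suc One_nat_def)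
    then show ?thesis
    proof cases
      case 1
      then show ?thesis by simp
    next
      case 2
      then have "m \<noteq> 0" by auto
      then show ?thesis using 2 limit_dual_deg_1[OF 2, of g v j]
        by (simp add: E sum_distrib_left mult_ac del: point.simps)
    next
      case 3
      then have "m \<noteq> 0" by auto
      then show ?thesis using 3
        by (simp add: E sum_distrib_left power2_eq_square distrib_left mult_ac del: point.simps)
    qed
  qed
  show "eval (point g v s Origin) f = K s Origin f"
    unfolding K_def coeff_functional_power_vec[symmetric] by (rule coeff_functional_cong) (rule O)
  show "eval (point g v s (Axis i)) f = K s Origin f + s * K s (Axis i) f"
    unfolding K_def coeff_functional_power_vec[symmetric] coeff_functional_add[symmetric]
      coeff_functional_mult[symmetric]
    by (rule coeff_functional_cong) (rule A)
  show "eval (point g v s (Extra j)) f = K s Origin f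
      + ((\<Sum>k\<in>UNIV. v j k * (s * K s (Axis k) f)) + s\<^sup>2 * K s (Extra j) f)"
    unfolding K_def coeff_functional_power_vec[symmetric] coeff_functional_add[symmetric]
      coeff_functional_mult[symmetric] coeff_functional_sum[symmetric]
    by (rule coeff_functional_cong) (rule E)
qed

lemma common_zeros_config:
  fixes g :: "'n::finite \<Rightarrow> 'n \<Rightarrow> 'k::field"
  assumes "s \<noteq> 0"
  shows "common_zeros (\<lambda>b f. coeff_functional (config_coeff g v s b) (shift a f)) (nodes r)
    = vanishing_ideal ((\<lambda>b i. point g v s b i + a i) ` nodes r)"
proof -
  have "(\<forall>b\<in>nodes r. coeff_functional (config_coeff g v s b) f = 0) \<longleftrightarrow>
      (\<forall>b\<in>nodes r. eval (point g v s b) f = 0)" for f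
    unfolding ball_nodes eval_point using assms by auto
  then show ?thesis
    by (simp add: common_zeros_def vanishing_ideal_def flip: eval_shift)
qed

text \<open>Coinciding points would give a nontrivial relation between the evaluations, and the
  triangular relation of \<open>eval_point\<close> turns it into one between the independent divided
  differences.\<close>

lemma inj_on_point:
  fixes g :: "'n::finite \<Rightarrow> 'n \<Rightarrow> 'k::field"
  assumes s: "s \<noteq> 0"
    and ind: "independent_on (\<lambda>b f. coeff_functional (config_coeff g v s b) (shift a f)) (nodes r)"
  shows "inj_on (\<lambda>b i. point g v s b i + a i) (nodes r)"
proof (rule inj_onI, rule ccontr)
  fix b b' assume b: "b \<in> nodes r" "b' \<in> nodes r" "b \<noteq> b'"
    and eq: "(\<lambda>i. point g v s b i + a i) = (\<lambda>i. point g v s b' i + a i)"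
  then have pt: "point g v s b = point g v s b'" by (auto simp: fun_eq_iff)
  define c :: "'n node \<Rightarrow> 'k" where "c x = (if x = b then 1 else if x = b' then - 1 else 0)" for x
  define K where "K b f = coeff_functional (config_coeff g v s b) f" for b f
  \<comment> \<open>The transpose of the triangular matrix applied to \<open>c\<close>; solving back
    from the \<open>Extra\<close> entries to \<open>Origin\<close> recovers \<open>c\<close> from
    \<open>c'\<close>.\<close>
  define c' where "c' x = (case x of
      Origin \<Rightarrow> \<Sum>y\<in>nodes r. c y
    | Axis i \<Rightarrow> s * (c (Axis i) + (\<Sum>j<r. c (Extra j) * v j i))
    | Extra j \<Rightarrow> s\<^sup>2 * c (Extra j))" for x
  have c0: "(\<Sum>x\<in>nodes r. c x * eval (point g v s x) f) = 0" for f
  proof -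
    have "(\<Sum>x\<in>nodes r. c x * eval (point g v s x) f)
        = (\<Sum>x\<in>nodes r. (if x = b then eval (point g v s b) f else 0) - (if x = b' then eval (point g v s b') f else 0))"
      by (rule sum.cong) (use b in \<open>auto simp: c_def\<close>)
    also have "\<dots> = 0" using b by (simp add: sum_subtractf pt)
    finally show ?thesis .
  qed
  have "(\<Sum>x\<in>nodes r. c' x * K x f) = (\<Sum>x\<in>nodes r. c x * eval (point g v s x) f)" for f
  proof -
    have "(\<Sum>x\<in>nodes r. c x * eval (point g v s x) f) = (\<Sum>y\<in>nodes r. c y) * K Origin f
        + ((\<Sum>i\<in>UNIV. c (Axis i) * s * K (Axis i) f)
          + ((\<Sum>j<r. \<Sum>i\<in>UNIV. c (Extra j) * v j i * s * K (Axis i) f)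
            + (\<Sum>j<r. s\<^sup>2 * c (Extra j) * K (Extra j) f)))"
      unfolding sum_nodes eval_point K_def[symmetric]
      by (simp add: distrib_left distrib_right sum.distrib sum_distrib_left sum_distrib_right mult_ac)
    also have "(\<Sum>j<r. \<Sum>i\<in>UNIV. c (Extra j) * v j i * s * K (Axis i) f)
        = (\<Sum>i\<in>UNIV. \<Sum>j<r. c (Extra j) * v j i * s * K (Axis i) f)"
      by (rule sum.swap)
    finally show ?thesis
      unfolding sum_nodes[of "\<lambda>x. c' x * K x f"]
      by (simp add: c'_def distrib_left distrib_right sum.distrib sum_distrib_left sum_distrib_right mult_ac)
  qed
  then have "(\<Sum>x\<in>nodes r. c' x * coeff_functional (config_coeff g v s x) (shift a f)) = 0" for f
    using c0[of "shift a f"] by (simp add: K_def)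
  then have c'0: "\<forall>x\<in>nodes r. c' x = 0"
    using ind unfolding independent_on_def by blast
  have E: "c (Extra j) = 0" if "j < r" for j
    using c'0 that s by (auto simp: ball_nodes c'_def)
  then have A: "c (Axis i) = 0" for i
    using c'0 s by (auto simp: ball_nodes c'_def)
  have "c Origin = 0"
    using c'0 E A by (simp add: ball_nodes c'_def sum_nodes)
  with A E have "\<forall>x\<in>nodes r. c x = 0" by (simp add: ball_nodes)
  then show False using b(1) by (auto simp: c_def)
qed

text \<open>Because \<open>0 ^ 0 = 1\<close>, at \<open>s = 0\<close> an \<open>Axis\<close>
  functional keeps exactly degree 1 and an \<open>Extra\<close> functional exactly degree 2. The
  \<open>Axis\<close> functionals apply the transpose of \<open>g\<close> to the linear
  coefficients, so its injectivity forces all of these to vanish.\<close>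

lemma common_zeros_config_0:
  fixes g :: "'n::finite \<Rightarrow> 'n \<Rightarrow> 'k::field"
  assumes g: "\<And>c. (\<And>i. (\<Sum>a\<in>UNIV. g a i * c a) = 0) \<Longrightarrow> (\<And>a. c a = 0)"
  shows "common_zeros (\<lambda>b f. coeff_functional (config_coeff g v 0 b) (shift a f)) (nodes r)
    = translate a (dual_ideal r (limit_dual g v))"
proof -
  have Ax: "coeff_functional (config_coeff g v 0 (Axis i)) f
      = (\<Sum>a\<in>UNIV. g a i * Poly_Mapping.lookup f (Poly_Mapping.single a 1))" for i f
  proof -
    have "config_coeff g v 0 (Axis i) m = (\<Sum>a\<in>UNIV. if m = Poly_Mapping.single a 1 then g a i else 0)" for m
    proof (cases "mdeg m = 1")
      case True
      then obtain b where b: "m = Poly_Mapping.single b 1" by (rule mdeg_1E)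
      moreover have "Poly_Mapping.single b (1::nat) = Poly_Mapping.single a 1 \<longleftrightarrow> a = b" for a
        by (metis keys_single singleton_inject zero_neq_one)
      moreover have "m \<noteq> 0" using True by auto
      ultimately show ?thesis by (simp add: b)
    next
      case False
      then have "m \<noteq> Poly_Mapping.single a 1" for a by auto
      moreover have "m = 0 \<or> 2 \<le> mdeg m" using False mdeg_eq_0_iff[of m] by linarith
      ultimately show ?thesis by (auto simp: power_0_left)
    qed
    then have "coeff_functional (config_coeff g v 0 (Axis i)) f
        = coeff_functional (\<lambda>m. \<Sum>a\<in>UNIV. if m = Poly_Mapping.single a 1 then g a i else 0) f"
      by (intro coeff_functional_cong)
    then show ?thesis
      by (simp only: coeff_functional_sum coeff_functional_single mult.commute)
  qed
  have "(\<forall>i. coeff_functional (config_coeff g v 0 (Axis i)) f = 0) \<longleftrightarrow>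
      (\<forall>i. Poly_Mapping.lookup f (Poly_Mapping.single i 1) = 0)" for f
    unfolding Ax using g[of "\<lambda>a. Poly_Mapping.lookup f (Poly_Mapping.single a 1)"] by auto
  moreover have "config_coeff g v 0 (Extra j) = dual_coeff (limit_dual g v) (Extra j)" for j
    by (rule ext) (auto simp: power_0_left)
  ultimately show ?thesis
    unfolding common_zeros_def translate_shift dual_ideal_common_zeros ball_nodes
    by (simp add: coeff_functional_single)
qed

definition singular_perturbation :: "'x set \<Rightarrow> ('x \<Rightarrow> 'x \<Rightarrow> 'k) \<Rightarrow> 'k::field \<Rightarrow> bool"
  where "singular_perturbation X E t \<longleftrightarrow>
    (\<exists>c. (\<forall>x\<in>X. (\<Sum>y\<in>X. ((if x = y then 1 else 0) + t * E x y) * c y) = 0) \<and> (\<exists>y\<in>X. c y \<noteq> 0))"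

text \<open>The determinant of the identity plus \<open>t\<close> times \<open>E\<close> is
  polynomial in \<open>t\<close> and nonzero at \<open>t = 0\<close>.\<close>

lemma finite_singular_perturbations:
  fixes E :: "'x \<Rightarrow> 'x \<Rightarrow> 'k::field"
  assumes X: "finite X"
  shows "finite {t. singular_perturbation X E t}"
proof -
  define A where "A t x y = (if x = y then 1 else 0) + t * E x y" for t x y
  have A: "(\<lambda>t. A t x y) \<in> polyfuns1" for x y
    unfolding A_def by (intro polyfuns_intros polyfuns.gen) simp
  have inj: "c y = 0" if "\<And>x. x \<in> X \<Longrightarrow> (\<Sum>y\<in>X. A 0 x y * c y) = 0" "y \<in> X" for c y
  proof -
    have "(\<Sum>z\<in>X. A 0 y z * c z) = (\<Sum>z\<in>X. if y = z then c z else 0)"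
      by (rule sum.cong) (auto simp: A_def)
    then show ?thesis using that X by simp
  qed
  obtain D N where D: "D \<in> polyfuns1" "D 0 \<noteq> 0"
    and N: "\<And>t y y'. y \<in> X \<Longrightarrow> y' \<in> X \<Longrightarrow> (\<Sum>x\<in>X. N t y x * A t x y') = (if y = y' then D t else 0)"
  proof (rule polyfuns_adjugate[of X X A "{\<lambda>t. t}" 0, OF X X refl A])
    show "c y = 0" if "\<And>x. x \<in> X \<Longrightarrow> (\<Sum>y\<in>X. A 0 x y * c y) = 0" "y \<in> X" for c y
      using that by (rule inj)
  qed (rule that; assumption)
  have "D t = 0" if c: "\<forall>x\<in>X. (\<Sum>y\<in>X. A t x y * c y) = 0" and y: "y \<in> X" "c y \<noteq> 0" for t c y
  proof -
    have "0 = (\<Sum>x\<in>X. N t y x * (\<Sum>y'\<in>X. A t x y' * c y'))" using c by simp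
    also have "\<dots> = (\<Sum>y'\<in>X. (\<Sum>x\<in>X. N t y x * A t x y') * c y')"
      unfolding sum_distrib_right sum_distrib_left by (subst sum.swap) (simp add: mult.assoc)
    also have "\<dots> = (\<Sum>y'\<in>X. if y = y' then D t * c y' else 0)"
      by (rule sum.cong) (auto simp: N y)
    also have "\<dots> = D t * c y" using X y by simp
    finally show ?thesis using y by simp
  qed
  then have "{t. \<exists>c. (\<forall>x\<in>X. (\<Sum>y\<in>X. A t x y * c y) = 0) \<and> (\<exists>y\<in>X. c y \<noteq> 0)} \<subseteq> {t. D t = 0}"
    by blast
  then show ?thesis
    unfolding A_def singular_perturbation_def using polyfuns1_finite_zeros[OF D] by (rule finite_subset)
qed


section \<open>First-order curves of configurations\<close>

lemma poly_power_vec: "poly (power_vec X m) c = power_vec (\<lambda>v. poly (X v) c) m"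
  by (simp add: power_vec_def poly_prod)

lemma poly_limit_dual:
  "poly (limit_dual g v i) c = limit_dual (\<lambda>a k. poly (g a k) c) (\<lambda>j k. poly (v j k) c) i"
  by (cases i) (simp add: limit_dual_def poly_power_vec poly_sum)

text \<open>This is the entry at \<open>(a, b)\<close> of \<open>g (v v^T - diag v) g^T\<close> for
  the vector \<open>v j\<close>.\<close>

lemma limit_dual_deg_2:
  "limit_dual g v (j, Poly_Mapping.single a 1 + Poly_Mapping.single b 1) =
    (\<Sum>k\<in>UNIV. g a k * v j k) * (\<Sum>k\<in>UNIV. g b k * v j k) - (\<Sum>k\<in>UNIV. v j k * (g a k * g b k))"
  by (simp add: limit_dual_def power_vec_add)

lemma mult_delta_left: "(if b then x else 0) * y = (if b then x * y else 0)" for x y :: "'a::semiring_0"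
  by simp

lemma mult_delta_right: "y * (if b then x else 0) = (if b then y * x else 0)" for x y :: "'a::semiring_0"
  by simp

lemma coeff_mult_1: "coeff (p * q) 1 = coeff p 0 * coeff q 1 + coeff p 1 * coeff q 0"
  by (simp add: coeff_mult)

text \<open>
  Surjectivity of the differential at \<open>(1, 1, v)\<close> of the map described at the beginning, in the
  directions \<open>H\<close>, \<open>A\<close> and \<open>u - A v\<close>: here \<open>u\<^sub>j\<close> is the first order variation of the product \<open>g v\<^sub>j\<close>,
  not of \<open>v\<^sub>j\<close>.
\<close>

definition infinitesimally_surjective :: "nat \<Rightarrow> (nat \<Rightarrow> 'n::finite \<Rightarrow> 'k::field) \<Rightarrow> bool"
  where "infinitesimally_surjective r v \<longleftrightarrow> (\<forall>z. (\<forall>j a b. z j a b = z j b a) \<longrightarrow>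
    (\<exists>A u H. \<forall>j<r. \<forall>a b. z j a b =
      u j a * v j b + v j a * u j b - (if a = b then u j a else 0)
      + ((if a = b then \<Sum>k\<in>UNIV. A a k * v j k else 0) - v j b * A a b - v j a * A b a)
      + (\<Sum>l<r. H j l * (v l a * v l b - (if a = b then v l a else 0)))))"

text \<open>The curve is linear in each parameter: \<open>h = 1 + t H\<close>,
  \<open>g = 1 + t A\<close> and \<open>v + t u\<close>. Its first-order term is the tangent vector
  described by \<open>infinitesimally_surjective\<close>, which can be made equal to any prescribed
  \<open>z\<close>.\<close>

lemma first_order_curve:
  fixes v :: "nat \<Rightarrow> 'n::finite \<Rightarrow> 'k::field"
  assumes surj: "infinitesimally_surjective r v"
  shows "\<exists>A u H. \<forall>j m. j < r \<longrightarrow> mdeg m = 2 \<longrightarrow>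
    coeff (\<Sum>l<r. [:if j = l then 1 else 0, H j l:] *
      limit_dual (\<lambda>a k. [:if a = k then 1 else 0, A a k:]) (\<lambda>j k. [:v j k, u j k:]) (l, m)) 0
      = limit_dual (\<lambda>a k. if a = k then 1 else 0) v (j, m) \<and>
    coeff (\<Sum>l<r. [:if j = l then 1 else 0, H j l:] *
      limit_dual (\<lambda>a k. [:if a = k then 1 else 0, A a k:]) (\<lambda>j k. [:v j k, u j k:]) (l, m)) 1
      = z (j, m)"
proof -
  \<comment> \<open>Reading \<open>z\<close> at a sum of two unit exponents makes the required
    symmetry automatic.\<close>
  define z' where "z' j a b = z (j, Poly_Mapping.single a 1 + Poly_Mapping.single b 1)" for j a b
  have sym: "\<forall>j a b. z' j a b = z' j b a" by (simp add: z'_def add.commute)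
  obtain A q H where "\<forall>j<r. \<forall>a b. z' j a b =
      q j a * v j b + v j a * q j b - (if a = b then q j a else 0)
      + ((if a = b then \<Sum>k\<in>UNIV. A a k * v j k else 0) - v j b * A a b - v j a * A b a)
      + (\<Sum>l<r. H j l * (v l a * v l b - (if a = b then v l a else 0)))"
    using infinitesimally_surjective_def[THEN iffD1, OF surj, THEN spec[of _ z'], THEN mp, OF sym]
    by (elim exE) (rule that)
  then have AqH: "z' j a b =
      q j a * v j b + v j a * q j b - (if a = b then q j a else 0)
      + ((if a = b then \<Sum>k\<in>UNIV. A a k * v j k else 0) - v j b * A a b - v j a * A b a)
      + (\<Sum>l<r. H j l * (v l a * v l b - (if a = b then v l a else 0)))" if "j < r" for j a b
    using that by blast
  \<comment> \<open>The tangent condition supplies the variation \<open>q\<close> of the product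
    \<open>g v\<close>; by the product rule the variation of \<open>v\<close> itself is
    \<open>q - A v\<close>.\<close>
  define u where "u j a = q j a - (\<Sum>k\<in>UNIV. A a k * v j k)" for j a
  define g where "g a k = [:if a = k then 1 else 0, A a k:]" for a k
  define V where "V j k = [:v j k, u j k:]" for j k
  define h where "h j l = [:if j = l then 1 else 0, H j l:]" for j l
  have p0: "coeff (\<Sum>k\<in>UNIV. g a k * V j k) 0 = v j a" for a j
    by (simp add: g_def V_def coeff_sum mult_delta_left mult_delta_right)
  have p1: "coeff (\<Sum>k\<in>UNIV. g a k * V j k) 1 = q j a" for a j
    unfolding coeff_sum coeff_mult_1
    by (simp add: g_def V_def u_def sum.distrib mult_delta_left mult_delta_right)
  have d0: "coeff (\<Sum>k\<in>UNIV. V j k * (g a k * g b k)) 0 = (if a = b then v j a else 0)" for a b j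
    by (simp add: g_def V_def coeff_sum mult_delta_left mult_delta_right)
  have d1: "coeff (\<Sum>k\<in>UNIV. V j k * (g a k * g b k)) 1
      = (if a = b then u j a else 0) + v j b * A a b + v j a * A b a" for a b j
    unfolding coeff_sum coeff_mult_1 coeff_mult_0
    by (simp add: g_def V_def distrib_left sum.distrib mult_delta_left mult_delta_right)
  let ?m = "\<lambda>a b. Poly_Mapping.single a 1 + Poly_Mapping.single b 1"
  have w0: "coeff (limit_dual g V (l, ?m a b)) 0 = v l a * v l b - (if a = b then v l a else 0)" for l a b
    unfolding limit_dual_deg_2 coeff_diff d0 coeff_mult_0 p0 by simp
  have w1: "coeff (limit_dual g V (l, ?m a b)) 1 = v l a * q l b + q l a * v l b
      - ((if a = b then u l a else 0) + v l b * A a b + v l a * A b a)" for l a b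
    unfolding limit_dual_deg_2 coeff_diff d1 coeff_mult_1 p0 p1 by simp
  have y: "limit_dual (\<lambda>a k. if a = k then 1 else 0) v (j, ?m a b)
      = v j a * v j b - (if a = b then v j a else 0)" for j a b
    unfolding limit_dual_deg_2 by (simp add: mult_delta_left mult_delta_right)
  have c0: "coeff (\<Sum>l<r. h j l * limit_dual g V (l, m)) 0
      = limit_dual (\<lambda>a k. if a = k then 1 else 0) v (j, m)" if j: "j < r" and deg: "mdeg m = 2" for j m
  proof -
    obtain a b where m: "m = ?m a b" using deg by (rule mdeg_2E)
    show ?thesis
      unfolding m coeff_sum coeff_mult_0 w0 y using j
      by (simp add: h_def mult_delta_left mult_delta_right)
  qed
  have c1: "coeff (\<Sum>l<r. h j l * limit_dual g V (l, m)) 1 = z (j, m)" if j: "j < r" and deg: "mdeg m = 2" for j m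
  proof -
    obtain a b where m: "m = ?m a b" using deg by (rule mdeg_2E)
    have "z (j, m) = z' j a b" by (simp add: z'_def m)
    also have "\<dots> = coeff (\<Sum>l<r. h j l * limit_dual g V (l, m)) 1"
      unfolding m coeff_sum coeff_mult_1 w0 w1 AqH[OF j] sum.distrib using j
      by (simp add: h_def u_def mult_delta_left mult_delta_right)
    finally show ?thesis by simp
  qed
  show ?thesis
    by (intro exI[of _ A] exI[of _ u] exI[of _ H] allI impI conjI)
      (simp_all only: c0[unfolded g_def[abs_def] V_def[abs_def] h_def] c1[unfolded g_def[abs_def] V_def[abs_def] h_def])
qed

section \<open>From the tangent condition to smoothability\<close>

lemma dual_ideal_cong:
  "(\<And>j m. j < r \<Longrightarrow> mdeg m = 2 \<Longrightarrow> w (j, m) = w' (j, m)) \<Longrightarrow> dual_ideal r w = dual_ideal r w'"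
proof -
  assume w: "\<And>j m. j < r \<Longrightarrow> mdeg m = 2 \<Longrightarrow> w (j, m) = w' (j, m)"
  have "(\<lambda>m. if mdeg m = 2 then w (j, m) else 0) = (\<lambda>m. if mdeg m = 2 then w' (j, m) else 0)" if "j < r" for j
    using w[OF that] by auto
  then show ?thesis unfolding dual_ideal_def by simp
qed

lemma dual_ideal_change_basis:
  fixes w :: "nat \<times> ('n \<Rightarrow>\<^sub>0 nat) \<Rightarrow> 'k::field"
  assumes h: "\<And>c. (\<And>j. j < r \<Longrightarrow> (\<Sum>l<r. h j l * c l) = 0) \<Longrightarrow> (\<And>l. l < r \<Longrightarrow> c l = 0)"
  shows "dual_ideal r (\<lambda>(j, m). \<Sum>l<r. h j l * w (l, m)) = dual_ideal r w"
proof -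
  define L where "L j = coeff_functional (\<lambda>m. if mdeg m = 2 then w (j, m) else 0)" for j
  have "coeff_functional (\<lambda>m. if mdeg m = 2 then \<Sum>l<r. h j l * w (l, m) else 0) f
      = (\<Sum>l<r. h j l * L l f)" for j f
    unfolding L_def coeff_functional_mult[symmetric] coeff_functional_sum[symmetric]
    by (rule coeff_functional_cong) simp
  moreover have "(\<forall>j<r. (\<Sum>l<r. h j l * L l f) = 0) \<longleftrightarrow> (\<forall>j<r. L j f = 0)" for f
    using h[of "\<lambda>l. L l f"] by auto
  ultimately show ?thesis
    unfolding dual_ideal_def prod.case L_def[symmetric] by simp
qed

text \<open>The family of divided differences in \<open>s\<close> has the given ideal at
  \<open>s = 0\<close>. Avoiding 0 and the finitely many zeros of \<open>G\<close> leaves an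
  \<open>s\<close> for which the member is a vanishing ideal; independence of the functionals makes
  its points distinct and so gives the right cardinality.\<close>

lemma point_ideal_in_open:
  fixes g :: "'n::finite \<Rightarrow> 'n \<Rightarrow> 'k::field_char_0"
  assumes U: "openin (hilb_topology (1 + CARD('n) + r)) U"
    and mem: "translate a (dual_ideal r (limit_dual g v)) \<in> U"
    and g: "\<And>c. (\<And>i. (\<Sum>a\<in>UNIV. g a i * c a) = 0) \<Longrightarrow> (\<And>a. c a = 0)"
  shows "\<exists>P. finite P \<and> card P = 1 + CARD('n) + r \<and> vanishing_ideal P \<in> U"
proof -
  define L where "L s b f = coeff_functional (config_coeff g v s b) (shift a f)" for s b f
  have lin: "linear_functional (L s b)" for s b
    unfolding L_def by (intro linear_functional_shift linear_functional_coeff_functional)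
  have poly: "(\<lambda>s. L s b (monomial m)) \<in> polyfuns1" for b m
    unfolding L_def coeff_functional_def
    by (intro polyfuns_sum polyfuns.mult polyfuns.const config_coeff_polyfuns)
  have "common_zeros (L 0) (nodes r) \<in> U"
    unfolding L_def[abs_def] using mem by (subst common_zeros_config_0) (rule g)
  then obtain G where G: "G \<in> polyfuns1" "G 0 \<noteq> 0" "\<And>s. G s \<noteq> 0 \<Longrightarrow> independent_on (L s) (nodes r) \<and>
      (poly_ideal.subspace (common_zeros (L s) (nodes r)) \<longrightarrow> common_zeros (L s) (nodes r) \<in> U)"
    using hilb_open_polyfuns[of L "nodes r" "{\<lambda>t. t}" U 0, OF lin poly finite_nodes]
      U[folded card_nodes] by blast
  have "finite (insert 0 {s. G s = 0})"
    using polyfuns1_finite_zeros[OF G(1,2)] by simp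
  then obtain s where s: "s \<noteq> 0" "G s \<noteq> 0"
    using ex_new_if_finite[OF infinite_UNIV_char_0] by blast
  let ?P = "(\<lambda>b i. point g v s b i + a i) ` nodes r"
  have zeros: "common_zeros (L s) (nodes r) = vanishing_ideal ?P"
    unfolding L_def[abs_def] by (rule common_zeros_config[OF s(1)])
  have "card ?P = 1 + CARD('n) + r"
    using card_image[OF inj_on_point[OF s(1), of g v a r]] G(3)[OF s(2)]
    by (simp add: L_def[abs_def] card_nodes)
  moreover have "vanishing_ideal ?P \<in> U"
    using G(3)[OF s(2)] unfolding zeros by (simp add: subspace_vanishing_ideal)
  ultimately show ?thesis by (meson finite_imageI finite_nodes)
qed

text \<open>The neighbourhood \<open>U\<close> yields a polynomial function \<open>G\<close> with
  \<open>G w \<noteq> 0\<close>. As \<open>G\<close> is not identically zero, it is nonzero at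
  almost all points of a suitable curve through the tuple \<open>y\<close> belonging to
  \<open>v\<close>. On the curve the ideals are limits of point ideals, so no path from
  \<open>w\<close> to \<open>y\<close> is involved.\<close>

lemma dual_ideal_smoothable:
  fixes v :: "nat \<Rightarrow> 'n::finite \<Rightarrow> 'k::field_char_0" and a :: "'n \<Rightarrow> 'k"
  assumes surj: "infinitesimally_surjective r v"
    and hilb: "translate a (dual_ideal r w) \<in> hilb (1 + CARD('n) + r)"
  shows "translate a (dual_ideal r w) \<in> smoothable_component (1 + CARD('n) + r)"
  unfolding smoothable_component_def in_closure_of topspace_hilb_topology
proof (intro conjI allI impI hilb, elim conjE)
  fix U assume mem: "translate a (dual_ideal r w) \<in> U"
    and U: "openin (hilb_topology (1 + CARD('n) + r)) U"
  define L where "L w b f = coeff_functional (dual_coeff w b) (shift a f)" for w b f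
  have zeros: "common_zeros (L w) (nodes r) = translate a (dual_ideal r w)" for w
    by (simp add: L_def common_zeros_def translate_shift dual_ideal_common_zeros)
  have lin: "linear_functional (L w b)" for w b
    unfolding L_def by (intro linear_functional_shift linear_functional_coeff_functional)
  have "(\<lambda>w. dual_coeff w b m) \<in> polyfuns (range (\<lambda>i w. w i))" for b :: "'n node" and m
  proof (cases b)
    case (Extra j)
    have "(\<lambda>w. w (j, m)) \<in> polyfuns (range (\<lambda>i w. w i))" by (rule polyfuns.gen) simp
    then show ?thesis using polyfuns.const[of 0] by (cases "mdeg m = 2") (simp_all add: Extra)
  qed (simp_all add: polyfuns.const)
  then have poly: "(\<lambda>w. L w b (monomial m)) \<in> polyfuns (range (\<lambda>i w. w i))" for b m
    unfolding L_def coeff_functional_def by (intro polyfuns_sum polyfuns.mult polyfuns.const)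
  obtain G where G: "G \<in> polyfuns (range (\<lambda>i w. w i))" "G w \<noteq> 0"
      "\<And>w. G w \<noteq> 0 \<Longrightarrow> translate a (dual_ideal r w) \<in> U"
    using hilb_open_polyfuns[of L "nodes r" "range (\<lambda>i w. w i)" U w, OF lin poly finite_nodes]
      U[folded card_nodes] mem subspace_translate[OF subspace_dual_ideal]
    unfolding zeros by blast
  \<comment> \<open>The base point of the curve: the quadrics of the configuration \<open>v\<close>,
    with 0 in the coordinates that \<open>dual_ideal\<close> ignores.\<close>
  define y where "y = (\<lambda>(j, m :: 'n \<Rightarrow>\<^sub>0 nat). if j < r \<and> mdeg m = 2
    then limit_dual (\<lambda>a k. if a = k then 1 else 0) v (j, m) else 0)"
  obtain z where z: "\<And>p. (\<And>i. coeff (p i) 0 = y i) \<Longrightarrow> (\<And>i. coeff (p i) 1 = z i) \<Longrightarrow>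
      finite {c. G (\<lambda>i. poly (p i) c) = 0}"
  proof (rule polyfuns_nonzero_direction[OF G(1,2), of y])
    fix z assume z: "\<And>p. (\<And>i. coeff (p i) 0 = y i) \<Longrightarrow> (\<And>i. coeff (p i) 1 = z i) \<Longrightarrow>
      finite {c. G (\<lambda>i. poly (p i) c) = 0}"
    show thesis by (rule that) (rule z)
  qed
  obtain A u H where AuH: "\<forall>j m. j < r \<longrightarrow> mdeg m = 2 \<longrightarrow>
      coeff (\<Sum>l<r. [:if j = l then 1 else 0, H j l:] *
      limit_dual (\<lambda>a k. [:if a = k then 1 else 0, A a k:]) (\<lambda>j k. [:v j k, u j k:]) (l, m)) 0
        = limit_dual (\<lambda>a k. if a = k then 1 else 0) v (j, m) \<and>
      coeff (\<Sum>l<r. [:if j = l then 1 else 0, H j l:] *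
      limit_dual (\<lambda>a k. [:if a = k then 1 else 0, A a k:]) (\<lambda>j k. [:v j k, u j k:]) (l, m)) 1
        = z (j, m)"
    using first_order_curve[OF surj, of z] by (elim exE) (rule that)
  \<comment> \<open>The direction \<open>z\<close> is prescribed in every coordinate, including
    those that \<open>dual_ideal\<close> ignores; there a straight line from 0 meets the
    requirement.\<close>
  define p where "p = (\<lambda>(j, m). if j < r \<and> mdeg m = 2 then \<Sum>l<r. [:if j = l then 1 else 0, H j l:] *
        limit_dual (\<lambda>a k. [:if a = k then 1 else 0, A a k:]) (\<lambda>j k. [:v j k, u j k:]) (l, m)
      else [:0, z (j, m):])"
  have "coeff (p i) 0 = y i" "coeff (p i) 1 = z i" for i
    using AuH[rule_format, of "fst i" "snd i"] by (cases i; simp add: p_def y_def)+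
  then have fin: "finite {t. G (\<lambda>i. poly (p i) t) = 0}" by (rule z)
  \<comment> \<open>Besides the zeros of \<open>G\<close>, the parameters where
    \<open>1 + t A\<close> or \<open>1 + t H\<close> is singular are excluded. \<open>A\<close>
    appears transposed because \<open>point_ideal_in_open\<close> asks for injectivity of the
    transpose of \<open>g\<close>.\<close>
  have "finite ({t. G (\<lambda>i. poly (p i) t) = 0} \<union>
      ({t. singular_perturbation (UNIV :: 'n set) (\<lambda>i a. A a i) t} \<union> {t. singular_perturbation {..<r} H t}))"
    by (intro finite_UnI fin finite_singular_perturbations) simp_all
  then have "\<exists>t. t \<notin> {t. G (\<lambda>i. poly (p i) t) = 0} \<union>
      ({t. singular_perturbation (UNIV :: 'n set) (\<lambda>i a. A a i) t} \<union> {t. singular_perturbation {..<r} H t})"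
    by (rule ex_new_if_finite[OF infinite_UNIV_char_0])
  then obtain t where "t \<notin> {t. G (\<lambda>i. poly (p i) t) = 0} \<union>
      ({t. singular_perturbation (UNIV :: 'n set) (\<lambda>i a. A a i) t} \<union> {t. singular_perturbation {..<r} H t})" ..
  then have t: "G (\<lambda>i. poly (p i) t) \<noteq> 0"
    and singular: "\<not> singular_perturbation UNIV (\<lambda>i a. A a i) t" "\<not> singular_perturbation {..<r} H t"
    by simp_all
  have g: "c a = 0" if "\<And>i. (\<Sum>a\<in>UNIV. ((if i = a then 1 else 0) + t * A a i) * c a) = 0" for c a
    using singular(1) that unfolding singular_perturbation_def by blast
  have h: "c l = 0" if "\<And>j. j < r \<Longrightarrow> (\<Sum>l<r. ((if j = l then 1 else 0) + t * H j l) * c l) = 0" "l < r" for c l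
    using singular(2) that unfolding singular_perturbation_def by blast
  define gt where "gt a k = (if a = k then 1 else 0) + t * A a k" for a k
  have gt_swap: "gt a i = (if i = a then 1 else 0) + t * A a i" for a i by (simp add: gt_def)
  define vt where "vt j k = v j k + t * u j k" for j k
  have "poly (p (j, m)) t = (\<Sum>l<r. ((if j = l then 1 else 0) + t * H j l) * limit_dual gt vt (l, m))"
    if "j < r" "mdeg m = 2" for j m
    using that by (simp add: p_def poly_sum poly_limit_dual gt_def[abs_def] vt_def[abs_def] distrib_right mult.assoc)
  then have "dual_ideal r (\<lambda>i. poly (p i) t)
      = dual_ideal r (\<lambda>(j, m). \<Sum>l<r. ((if j = l then 1 else 0) + t * H j l) * limit_dual gt vt (l, m))"
    by (intro dual_ideal_cong) simp
  also have "\<dots> = dual_ideal r (limit_dual gt vt)"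
    by (rule dual_ideal_change_basis) (rule h)
  finally have "translate a (dual_ideal r (limit_dual gt vt)) \<in> U"
    using G(3)[OF t] by simp
  then have "\<exists>P. finite P \<and> card P = 1 + CARD('n) + r \<and> vanishing_ideal P \<in> U"
    by (rule point_ideal_in_open[OF U]) (rule g, simp only: gt_swap)
  then show "\<exists>J. J \<in> {vanishing_ideal P |P. finite P \<and> card P = 1 + CARD('n) + r} \<and> J \<in> U"
    by blast
qed

theorem translated_one_step_locus_smoothable:
  fixes v :: "nat \<Rightarrow> 'n::finite \<Rightarrow> 'k::field_char_0"
  assumes "infinitesimally_surjective r v"
  shows "(translated_one_step_locus r :: ('n, 'k) mpoly set set)
    \<subseteq> smoothable_component (1 + CARD('n) + r)"
  unfolding translated_one_step_locus_def
\<comment> \<open>Intersecting with the underlying space supplies the membership in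
  \<open>hilb\<close> that \<open>dual_ideal_smoothable\<close> asks for.\<close>
proof (subst closure_of_restrict, rule closure_of_minimal)
  let ?S = "{translate a (one_step_ideal Q) | a (Q :: ('n, 'k) mpoly set). poly_vs.subspace Q \<and> Q \<subseteq> quadratic_forms \<and>
    poly_vs.dim Q + r = poly_vs.dim (quadratic_forms :: ('n, 'k) mpoly set)}"
  show "topspace (hilb_topology (1 + CARD('n) + r)) \<inter> ?S \<subseteq> smoothable_component (1 + CARD('n) + r)"
  proof
    fix I assume "I \<in> topspace (hilb_topology (1 + CARD('n) + r)) \<inter> ?S"
    then obtain a and Q :: "('n, 'k) mpoly set" where I: "I = translate a (one_step_ideal Q)"
      and Q: "poly_vs.subspace Q" "Q \<subseteq> quadratic_forms"
        "poly_vs.dim Q + r = poly_vs.dim (quadratic_forms :: ('n, 'k) mpoly set)"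
      and hilb: "I \<in> hilb (1 + CARD('n) + r)"
      unfolding topspace_hilb_topology by blast
    obtain w where "one_step_ideal Q = dual_ideal r w"
      by (rule one_step_ideal_dual_ideal[OF Q])
    then show "I \<in> smoothable_component (1 + CARD('n) + r)"
      using dual_ideal_smoothable[OF assms] hilb by (simp add: I)
  qed
qed (simp add: smoothable_component_def)

section \<open>The rank condition\<close>

text \<open>For the indicator vector \<open>v\<close> of a pair, \<open>v v^T - diag v\<close> has
  entries 1 at the two off-diagonal positions of the pair and 0 elsewhere. So \<open>H\<close>
  adjusts every off-diagonal entry independently, \<open>A = 0\<close> suffices, and
  \<open>u\<close> only has to produce the diagonal.\<close>

lemma infinitesimally_surjective_edges:
  assumes r: "CARD('n::finite) choose 2 \<le> r"
  shows "\<exists>v :: nat \<Rightarrow> 'n \<Rightarrow> 'k::field_char_0. infinitesimally_surjective r v"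
proof -
  define N where "N = CARD('n) choose 2"
  have "card {S :: 'n set. card S = 2} = N"
    using n_subsets[of "UNIV :: 'n set" 2] by (simp add: N_def)
  then obtain e where e: "bij_betw e {..<N} {S :: 'n set. card S = 2}"
    using ex_bij_betw_nat_finite[of "{S :: 'n set. card S = 2}"] by (auto simp: atLeast0LessThan)
  \<comment> \<open>The vectors beyond the edges are 0. The configuration at \<open>v\<close> may
    thus have coinciding points; only the differential there matters.\<close>
  define v :: "nat \<Rightarrow> 'n \<Rightarrow> 'k" where "v l a = (if l < N \<and> a \<in> e l then 1 else 0)" for l a
  have "infinitesimally_surjective r v"
    unfolding infinitesimally_surjective_def
  proof (intro allI impI)
    fix z :: "nat \<Rightarrow> 'n \<Rightarrow> 'n \<Rightarrow> 'k" assume sym: "\<forall>j a b. z j a b = z j b a"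
    \<comment> \<open>On the diagonal \<open>u\<close> enters with the factor
      \<open>2 v - 1\<close>, which is 1 or -1 because \<open>v\<close> has entries 0 and 1.\<close>
    define u where "u j a = z j a a / (2 * v j a - 1)" for j a
    define f where "f j a b = z j a b - (u j a * v j b + v j a * u j b)" for j a b
    \<comment> \<open>\<open>H\<close> is indexed by unordered pairs; \<open>SOME\<close> orders the
      pair, and the symmetry of \<open>f\<close> makes the choice immaterial.\<close>
    define F where "F j S = (case SOME p. S = {fst p, snd p} of (a, b) \<Rightarrow> f j a b)" for j S
    have f_sym: "f j a b = f j b a" for j a b
      using sym by (simp add: f_def algebra_simps)
    have F: "F j {a, b} = f j a b" for j a b
    proof -
      obtain p where p: "(SOME p. {a, b} = {fst p, snd p}) = p" by simp
      have "{a, b} = {fst p, snd p}"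
        unfolding p[symmetric] by (rule someI[of _ "(a, b)"]) simp
      then have "p = (a, b) \<or> p = (b, a)" by (cases p) (auto simp: doubleton_eq_iff)
      then show ?thesis unfolding F_def p using f_sym by auto
    qed
    have M: "(\<Sum>l<r. (if l < N then F j (e l) else 0) * (v l a * v l b - (if a = b then v l a else 0)))
        = (if a = b then 0 else f j a b)" for j a b
    proof (cases "a = b")
      case True
      then show ?thesis by (auto simp: v_def intro!: sum.neutral)
    next
      case False
      then have "{a, b} \<in> e ` {..<N}" using e by (simp add: bij_betw_def)
      then obtain l0 where l0: "l0 < N" "e l0 = {a, b}" by auto
      have iff: "a \<in> e l \<and> b \<in> e l \<longleftrightarrow> l = l0" if l: "l < N" for l
      proof
        assume ab: "a \<in> e l \<and> b \<in> e l"
        have "card (e l) = 2" using e l by (auto simp: bij_betw_def)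
        then have "e l = {a, b}"
          using ab False by (metis card_2_iff insertE singletonD insert_commute)
        then show "l = l0" using inj_onD[OF bij_betw_imp_inj_on[OF e], of l l0] l l0 by simp
      qed (simp add: l0)
      have "(\<Sum>l<r. (if l < N then F j (e l) else 0) * (v l a * v l b - (if a = b then v l a else 0)))
          = (\<Sum>l<r. if l = l0 then F j (e l0) else 0)"
        by (rule sum.cong) (use False iff l0 in \<open>auto simp: v_def\<close>)
      then show ?thesis using l0 r False by (simp add: N_def F)
    qed
    have "z j a a = 2 * u j a * v j a - u j a" for j a
      by (simp add: u_def v_def)
    then have "z j a b = u j a * v j b + v j a * u j b - (if a = b then u j a else 0)
        + ((if a = b then \<Sum>k\<in>UNIV. 0 * v j k else 0) - v j b * 0 - v j a * 0)
        + (\<Sum>l<r. (if l < N then F j (e l) else 0) * (v l a * v l b - (if a = b then v l a else 0)))" for j a b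
      unfolding M by (simp add: f_def algebra_simps)
    then show "\<exists>A u H. \<forall>j<r. \<forall>a b. z j a b =
        u j a * v j b + v j a * u j b - (if a = b then u j a else 0)
        + ((if a = b then \<Sum>k\<in>UNIV. A a k * v j k else 0) - v j b * A a b - v j a * A b a)
        + (\<Sum>l<r. H j l * (v l a * v l b - (if a = b then v l a else 0)))"
      by (intro exI[of _ "\<lambda>_ _. 0"] exI[of _ u] exI[of _ "\<lambda>j l. if l < N then F j (e l) else 0"]) blast
  qed
  then show ?thesis by blast
qed

section \<open>Fraction-free elimination on sparse integer rows\<close>

type_synonym sparse_row = "(int \<times> int) list"

fun row_val :: "sparse_row \<Rightarrow> int \<Rightarrow> int"
  where
    "row_val [] k = 0"
  | "row_val ((i, x) # xs) k = (if i = k then x + row_val xs k else row_val xs k)"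

text \<open>A merge of rows sorted by key. Cancelled entries are removed instead of being stored as
  0, so rows stay short and a vanishing row becomes \<open>[]\<close>.\<close>

fun row_comb :: "int \<Rightarrow> sparse_row \<Rightarrow> int \<Rightarrow> sparse_row \<Rightarrow> sparse_row"
  where
    "row_comb a [] b ys = map (\<lambda>(j, y). (j, b * y)) ys"
  | "row_comb a ((i, x) # xs) b [] = map (\<lambda>(i, x). (i, a * x)) ((i, x) # xs)"
  | "row_comb a ((i, x) # xs) b ((j, y) # ys) =
      (if i < j then (i, a * x) # row_comb a xs b ((j, y) # ys)
       else if j < i then (j, b * y) # row_comb a ((i, x) # xs) b ys
       else let s = a * x + b * y in
         if s = 0 then row_comb a xs b ys else (i, s) # row_comb a xs b ys)"

lemma row_val_map: "row_val (map (\<lambda>(i, x). (i, a * x)) xs) k = a * row_val xs k"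
  by (induction xs) (auto simp: distrib_left)

lemma row_val_row_comb: "row_val (row_comb a xs b ys) k = a * row_val xs k + b * row_val ys k"
  by (induction a xs b ys rule: row_comb.induct)
    (auto simp: row_val_map distrib_left Let_def algebra_simps)

text \<open>A pivot entry 1 or -1 multiplies the other rows only by a unit, which slows the growth
  of the integers.\<close>

definition pivot :: "sparse_row \<Rightarrow> int"
  where "pivot xs = fst (case find (\<lambda>(k, x). x = 1 \<or> x = - 1) xs of Some p \<Rightarrow> p | None \<Rightarrow> hd xs)"

definition reduce :: "int \<Rightarrow> int \<Rightarrow> sparse_row \<Rightarrow> sparse_row \<Rightarrow> sparse_row"
  where "reduce c a p xs = (let h = row_val xs c in if h = 0 then xs else row_comb a xs (- h) p)"

text \<open>Only the pivot keys are returned: compared with the support of the rows they already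
  certify full rank. Dropping a row whose pivot value is 0 is sound, since its support is still
  tested in \<open>eliminate_spans\<close>.\<close>

fun eliminate :: "sparse_row list \<Rightarrow> int list"
  where
    "eliminate [] = []"
  | "eliminate (p # ps) = (if p = [] then eliminate ps else
      let c = pivot p; a = row_val p c in
        if a = 0 then eliminate ps else c # eliminate (map (reduce c a p) ps))"

lemma row_val_reduce: "row_val p c = a \<Longrightarrow> row_val (reduce c a p xs) c = 0"
  by (simp add: reduce_def Let_def row_val_row_comb)

lemma closed_linear_combination:
  fixes U :: "('i \<Rightarrow> 'k::comm_ring_1) set"
  assumes zero: "(\<lambda>_. 0) \<in> U"
    and add: "\<And>x y. x \<in> U \<Longrightarrow> y \<in> U \<Longrightarrow> (\<lambda>i. x i + y i) \<in> U"
    and scale: "\<And>c x. x \<in> U \<Longrightarrow> (\<lambda>i. c * x i) \<in> U"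
    and f: "\<And>k. k \<in> B \<Longrightarrow> f k \<in> U"
  shows "(\<lambda>i. \<Sum>k\<in>B. y k * f k i) \<in> U"
  using f
proof (induction B rule: infinite_finite_induct)
  case (insert k B)
  then have "(\<lambda>i. y k * f k i + (\<Sum>k\<in>B. y k * f k i)) \<in> U"
    by (intro add scale) simp_all
  then show ?case using insert.hyps by simp
qed (simp_all add: zero)

text \<open>If every key in the support is a pivot, the echelon form is square. The reduced rows
  avoid the first pivot key and satisfy the same hypothesis, so the induction yields the other unit
  vectors, and the first row then yields its own.\<close>

lemma eliminate_spans:
  fixes U :: "(int \<Rightarrow> 'k::field_char_0) set"
  assumes zero: "(\<lambda>_. 0) \<in> U"
    and add: "\<And>x y. x \<in> U \<Longrightarrow> y \<in> U \<Longrightarrow> (\<lambda>i. x i + y i) \<in> U"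
    and scale: "\<And>c x. x \<in> U \<Longrightarrow> (\<lambda>i. c * x i) \<in> U"
  shows "(\<And>xs. xs \<in> set ps \<Longrightarrow> (\<lambda>i. of_int (row_val xs i)) \<in> U) \<Longrightarrow>
    (\<And>xs i. xs \<in> set ps \<Longrightarrow> row_val xs i \<noteq> 0 \<Longrightarrow> i \<in> set (eliminate ps)) \<Longrightarrow>
    k \<in> set (eliminate ps) \<Longrightarrow> (\<lambda>i. if i = k then 1 else 0) \<in> U"
proof (induction ps arbitrary: k rule: eliminate.induct)
  case (2 p ps)
  define c where "c = pivot p"
  define a where "a = row_val p c"
  consider "p = []" | "p \<noteq> []" "a = 0" | "p \<noteq> []" "a \<noteq> 0" by blast
  then show ?case
  proof cases
    case 1
    show ?thesis
      by (rule "2.IH"(1)[OF 1]) (use "2.prems" 1 in auto)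
  next
    case 2
    then have "eliminate (p # ps) = eliminate ps" by (simp add: c_def a_def)
    note elim = this
    show ?thesis
    proof (rule "2.IH"(2)[OF 2(1) c_def a_def 2(2)])
      show "(\<lambda>i. of_int (row_val xs i)) \<in> U" if "xs \<in> set ps" for xs
        using "2.prems"(1) that by simp
      show "i \<in> set (eliminate ps)" if "xs \<in> set ps" "row_val xs i \<noteq> 0" for xs i
        using "2.prems"(2)[of xs i] that unfolding elim by simp
      show "k \<in> set (eliminate ps)" using "2.prems"(3) unfolding elim .
    qed
  next
    case 3
    define ps' where "ps' = map (reduce c a p) ps"
    have elim: "eliminate (p # ps) = c # eliminate ps'"
      using 3 by (simp add: c_def a_def ps'_def Let_def)
    have sub: "(\<lambda>i. x i + c * y i) \<in> U" if "x \<in> U" "y \<in> U" for x y c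
      using add[OF that(1) scale[OF that(2)]] .
    have in_U: "(\<lambda>i. of_int (row_val xs i)) \<in> U" if xs: "xs \<in> set ps'" for xs
    proof -
      obtain ys where ys: "ys \<in> set ps" "xs = reduce c a p ys"
        using xs by (auto simp: ps'_def)
      have "(\<lambda>i. of_int a * of_int (row_val ys i) + of_int (- row_val ys c) * of_int (row_val p i)) \<in> U"
        using "2.prems"(1) ys(1) by (intro add scale) auto
      then show ?thesis
        using "2.prems"(1)[of ys] ys by (auto simp: reduce_def Let_def row_val_row_comb)
    qed
    have supp: "i \<in> set (eliminate ps')" if xs: "xs \<in> set ps'" and i: "row_val xs i \<noteq> 0" for xs i
    proof -
      obtain ys where ys: "ys \<in> set ps" "xs = reduce c a p ys"
        using xs by (auto simp: ps'_def)
      have "i \<noteq> c" using i row_val_reduce[of p c a ys] ys(2) by (auto simp: a_def)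
      moreover have "row_val ys i \<noteq> 0 \<or> row_val p i \<noteq> 0"
        using i by (auto simp: ys(2) reduce_def Let_def row_val_row_comb split: if_splits)
      ultimately show ?thesis using "2.prems"(2)[of ys i] "2.prems"(2)[of p i] ys(1) elim by auto
    qed
    have IH: "(\<lambda>i. if i = k then 1 else 0) \<in> U" if "k \<in> set (eliminate ps')" for k
      using "2.IH"(3)[OF 3(1) c_def a_def 3(2), folded ps'_def, OF in_U supp that] .
    show ?thesis
    proof (cases "k \<in> set (eliminate ps')")
      case True
      then show ?thesis by (rule IH)
    next
      case False
      then have k: "k = c" using "2.prems"(3) elim by auto
      \<comment> \<open>Back substitution: the entries of \<open>p\<close> at the other pivots are
        subtracted, leaving \<open>a\<close> times the unit vector at \<open>c\<close>.\<close>
      let ?S = "set (eliminate ps') - {c}"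
      have "(\<lambda>i. \<Sum>k\<in>?S. - of_int (row_val p k) * (if i = k then 1 else 0)) \<in> U"
        by (rule closed_linear_combination[OF zero add scale]) (simp_all add: IH)
      moreover have "(\<lambda>i. of_int (row_val p i)) \<in> U" using "2.prems"(1) by simp
      ultimately have "(\<lambda>i. inverse (of_int a) * (of_int (row_val p i)
          + (\<Sum>k\<in>?S. - of_int (row_val p k) * (if i = k then 1 else 0)))) \<in> U"
        by (intro scale add)
      also have "(\<lambda>i. inverse (of_int a) * (of_int (row_val p i)
          + (\<Sum>k\<in>?S. - of_int (row_val p k) * (if i = k then 1 else 0)))) = (\<lambda>i. if i = k then 1 else 0 :: 'k)"
      proof
        fix i
        have "(\<Sum>k\<in>?S. - of_int (row_val p k) * (if i = k then 1 else 0 :: 'k)) = (if i \<in> ?S then - of_int (row_val p i) else 0)"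
          by (simp add: if_distrib[of "\<lambda>x. _ * x"] cong: if_cong)
        moreover have "row_val p i = 0" if "i \<notin> ?S" "i \<noteq> c"
          using "2.prems"(2)[of p i] that elim by auto
        ultimately show "inverse (of_int a) * (of_int (row_val p i)
          + (\<Sum>k\<in>?S. - of_int (row_val p k) * (if i = k then 1 else 0))) = (if i = k then 1 else 0 :: 'k)"
          using 3(2) by (auto simp: k a_def)
      qed
      finally show ?thesis .
    qed
  qed
qed simp

text \<open>
  The \<open>(a, b)\<close> entry, \<open>a \<le> b\<close>, of the \<open>j\<close>-th quadric is stored under the integer key
  \<open>25 * j + 5 * a + b\<close>; integers rather than natural numbers because \<open>code_simp\<close> computes with the
  latter in unary.
\<close>

definition quad_pairs :: "((nat \<times> nat) \<times> int) list"
  where "quad_pairs = concat (map (\<lambda>a. map (\<lambda>b. ((a, b), 5 * int a + int b)) [a..<5]) [0..<5])"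

definition block :: "nat \<Rightarrow> (nat \<Rightarrow> nat \<Rightarrow> int) \<Rightarrow> sparse_row"
  where "block j f = (let k = 25 * int j in
    filter (\<lambda>(i, x). x \<noteq> 0) (map (\<lambda>((a, b), i). (k + i, f a b)) quad_pairs))"

text \<open>The images of the coordinate directions \<open>H j l\<close>, \<open>u j k\<close> and
  \<open>A s t\<close> under the differential, \<open>r * (r + 5) + 25\<close> rows in all. The
  first two kinds lie in a single block and come first: reducing with them leaves the rows of other
  blocks untouched, and only the last 25 rows couple the blocks.\<close>

definition tangent_rows :: "int list list \<Rightarrow> sparse_row list"
  where "tangent_rows vs = (let r = length vs in
    concat (map (\<lambda>j.
      map (\<lambda>v. block j (\<lambda>a b. v ! a * v ! b - (if a = b then v ! a else 0))) vs @
      map (\<lambda>k. block j (\<lambda>a b. (if a = k then vs ! j ! b else 0) + (if b = k then vs ! j ! a else 0)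
        - (if a = k \<and> b = k then 1 else 0))) [0..<5]) [0..<r]) @
    concat (map (\<lambda>s. map (\<lambda>t. concat (map (\<lambda>j. block j (\<lambda>a b.
      (if a = s \<and> b = s then vs ! j ! t else 0) - (if a = s \<and> b = t then vs ! j ! b else 0)
        - (if b = s \<and> a = t then vs ! j ! a else 0))) [0..<r])) [0..<5]) [0..<5]))"

definition spanning :: "int list list \<Rightarrow> bool"
  where "spanning vs \<longleftrightarrow> (let K = eliminate (tangent_rows vs) in
    list_all (\<lambda>j. list_all (\<lambda>(_, i). 25 * int j + i \<in> set K) quad_pairs) [0..<length vs])"

section \<open>Correctness of the integer encoding\<close>

lemma row_val_nonzero_key: "row_val xs k \<noteq> 0 \<Longrightarrow> k \<in> fst ` set xs"
  by (induction xs) (auto split: if_splits)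

lemma row_val_append: "row_val (xs @ ys) k = row_val xs k + row_val ys k"
  by (induction xs) auto

lemma row_val_concat: "row_val (concat xss) k = (\<Sum>xs\<leftarrow>xss. row_val xs k)"
  by (induction xss) (auto simp: row_val_append)

lemma row_val_filter: "row_val (filter (\<lambda>(i, x). x \<noteq> 0) xs) k = row_val xs k"
proof (induction xs)
  case (Cons p xs)
  then show ?case by (cases p; cases "snd p = 0") simp_all
qed simp

lemma row_val_map_distinct:
  "distinct xs \<Longrightarrow> row_val (map (\<lambda>p. (key p, f p)) xs) k = (\<Sum>p\<in>{p \<in> set xs. key p = k}. f p)"
proof (induction xs)
  case (Cons x xs)
  have "{p \<in> set (x # xs). key p = k} = (if key x = k then insert x {p \<in> set xs. key p = k} else {p \<in> set xs. key p = k})"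
    by auto
  then show ?case using Cons by simp
qed simp

lemma set_quad_pairs: "((a, b), i) \<in> set quad_pairs \<longleftrightarrow> a \<le> b \<and> b < 5 \<and> i = 5 * int a + int b"
  by (force simp: quad_pairs_def)

lemma distinct_quad_pairs: "distinct quad_pairs"
  by code_simp

text \<open>Keys decode uniquely: \<open>5 * a + b\<close> is below 25 and \<open>b\<close> below 5,
  so division by 25 and the remainder modulo 5 recover the indices.\<close>

lemma row_val_block:
  assumes "a \<le> b" "b < 5"
  shows "row_val (block j f) (25 * int j' + (5 * int a + int b)) = (if j = j' then f a b else 0)"
proof -
  have "{p \<in> set quad_pairs. 25 * int j + snd p = 25 * int j' + (5 * int a + int b)}
      = (if j = j' then {((a, b), 5 * int a + int b)} else {})"
  proof -
    have "((c, d), i) \<in> set quad_pairs \<and> 25 * int j + i = 25 * int j' + (5 * int a + int b) \<longleftrightarrow>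
        j = j' \<and> c = a \<and> d = b \<and> i = 5 * int a + int b" for c d i
    proof -
      have quot: "(25 * int n + x) div 25 = int n" if "0 \<le> x" "x < 25" for n x
        using that by (simp add: div_pos_pos_trivial)
      have rem: "(5 * int m + int n) mod 5 = int n" if "n < 5" for m n
        using that by (simp add: mod_pos_pos_trivial)
      show ?thesis
      proof
        assume *: "((c, d), i) \<in> set quad_pairs \<and> 25 * int j + i = 25 * int j' + (5 * int a + int b)"
        then have cd: "c \<le> d" "d < 5" "i = 5 * int c + int d" by (simp_all add: set_quad_pairs)
        have eq: "25 * int j + i = 25 * int j' + (5 * int a + int b)" using * by blast
        have "int j = int j'"
          using quot[of i j] quot[of "5 * int a + int b" j'] eq cd assms by simp
        moreover from this eq have i: "i = 5 * int a + int b" by simp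
        moreover from i have "int d = int b"
          using rem[OF cd(2), of c] rem[OF assms(2), of a] cd(3) by metis
        ultimately show "j = j' \<and> c = a \<and> d = b \<and> i = 5 * int a + int b" using cd(3) by simp
      qed (use assms in \<open>simp add: set_quad_pairs\<close>)
    qed
    then have "q \<in> set quad_pairs \<and> 25 * int j + snd q = 25 * int j' + (5 * int a + int b) \<longleftrightarrow>
        j = j' \<and> q = ((a, b), 5 * int a + int b)" for q
      by (cases q; cases "fst q") auto
    then show ?thesis by (auto split: if_split)
  qed
  moreover have "(\<lambda>((a, b), i). (25 * int j + i, f a b)) = (\<lambda>p. (25 * int j + snd p, f (fst (fst p)) (snd (fst p))))"
    by auto
  ultimately show ?thesis
    by (simp add: block_def Let_def row_val_filter row_val_map_distinct[OF distinct_quad_pairs])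
qed

lemma block_keys: "fst ` set (block j f) \<subseteq> (\<lambda>p. 25 * int j + snd p) ` set quad_pairs"
  by (force simp: block_def Let_def)

lemma sum_list_upt_delta: "j < r \<Longrightarrow> (\<Sum>i\<leftarrow>[0..<r]. if i = j then f i else 0) = f j" for f :: "nat \<Rightarrow> int"
  by (subst interv_sum_list_conv_sum_set_nat) (simp add: sum.delta)

lemma tangent_rows_cases [consumes 1, case_names H u A]:
  assumes "xs \<in> set (tangent_rows vs)"
  obtains j l where "j < length vs" "l < length vs"
      "xs = block j (\<lambda>a b. vs ! l ! a * vs ! l ! b - (if a = b then vs ! l ! a else 0))"
    | j k where "j < length vs" "k < 5"
      "xs = block j (\<lambda>a b. (if a = k then vs ! j ! b else 0) + (if b = k then vs ! j ! a else 0)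
        - (if a = k \<and> b = k then 1 else 0))"
    | s t where "s < 5" "t < 5"
      "xs = concat (map (\<lambda>j. block j (\<lambda>a b.
        (if a = s \<and> b = s then vs ! j ! t else 0) - (if a = s \<and> b = t then vs ! j ! b else 0)
          - (if b = s \<and> a = t then vs ! j ! a else 0))) [0..<length vs])"
  using assms unfolding tangent_rows_def Let_def
  by (auto simp: in_set_conv_nth[of _ vs])

text \<open>The tangent space over \<open>'k\<close> contains the images of the integer rows, and a
  nonzero integer pivot stays invertible in characteristic zero, so the integer certificate
  transfers.\<close>

lemma spanning_imp_infinitesimally_surjective:
  assumes span: "spanning vs" and card: "CARD('n::finite) = 5"
  shows "\<exists>v :: nat \<Rightarrow> 'n \<Rightarrow> 'k::field_char_0. infinitesimally_surjective (length vs) v"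
proof -
  define r where "r = length vs"
  define V :: "nat \<Rightarrow> nat \<Rightarrow> 'k" where "V j a = of_int (vs ! j ! a)" for j a
  define T where "T A u H j a b = u j a * V j b + V j a * u j b - (if a = b then u j a else 0)
      + ((if a = b then \<Sum>k<5. A a k * V j k else 0) - V j b * A a b - V j a * A b a)
      + (\<Sum>l<r. H j l * (V l a * V l b - (if a = b then V l a else 0)))"
    for A :: "nat \<Rightarrow> nat \<Rightarrow> 'k" and u H :: "nat \<Rightarrow> nat \<Rightarrow> 'k" and j a b
  \<comment> \<open>The tangent space in key coordinates; values at integers that encode no entry
    are unconstrained.\<close>
  define U where "U = {z :: int \<Rightarrow> 'k. \<exists>A u H. \<forall>j<r. \<forall>a b. a \<le> b \<longrightarrow> b < 5 \<longrightarrow>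
    z (25 * int j + (5 * int a + int b)) = T A u H j a b}"
  define Keys where "Keys = (\<Union>j<r. (\<lambda>p. 25 * int j + snd p) ` set quad_pairs)"
  let ?R = "tangent_rows vs"
  have UI: "z \<in> U" if "\<And>j a b. j < r \<Longrightarrow> a \<le> b \<Longrightarrow> b < 5 \<Longrightarrow>
      z (25 * int j + (5 * int a + int b)) = T A u H j a b" for z A u H
    using that unfolding U_def by blast
  have zero: "(\<lambda>_. 0) \<in> U"
    by (rule UI[of _ "\<lambda>_ _. 0" "\<lambda>_ _. 0" "\<lambda>_ _. 0"]) (simp add: T_def)
  define SA where "SA A j a = (\<Sum>k<5. A a k * V j k)" for A :: "nat \<Rightarrow> nat \<Rightarrow> 'k" and j a
  define SH where "SH H j a b = (\<Sum>l<r. H j l * (V l a * V l b - (if a = b then V l a else 0)))"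
    for H :: "nat \<Rightarrow> nat \<Rightarrow> 'k" and j a b
  have S_add: "SA (\<lambda>i j. A i j + A' i j) j a = SA A j a + SA A' j a"
      "SH (\<lambda>i j. H i j + H' i j) j a b = SH H j a b + SH H' j a b" for A A' H H' j a b
    by (simp_all only: SA_def SH_def distrib_right sum.distrib)
  have S_scale: "SA (\<lambda>i j. c * A i j) j a = c * SA A j a"
      "SH (\<lambda>i j. c * H i j) j a b = c * SH H j a b" for c A H j a b
    by (simp_all only: SA_def SH_def mult.assoc sum_distrib_left)
  note T_alt = T_def[folded SA_def SH_def]
  have T_add: "T A u H j a b + T A' u' H' j a b
      = T (\<lambda>i j. A i j + A' i j) (\<lambda>i j. u i j + u' i j) (\<lambda>i j. H i j + H' i j) j a b" for A u H A' u' H' j a b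
    by (cases "a = b") (simp_all add: T_alt S_add algebra_simps)
  have T_scale: "c * T A u H j a b
      = T (\<lambda>i j. c * A i j) (\<lambda>i j. c * u i j) (\<lambda>i j. c * H i j) j a b" for c A u H j a b
    by (cases "a = b") (simp_all add: T_alt S_scale algebra_simps)
  have add: "(\<lambda>i. x i + y i) \<in> U" if xy: "x \<in> U" "y \<in> U" for x y
  proof -
    obtain A u H A' u' H' where *: "\<forall>j<r. \<forall>a b. a \<le> b \<longrightarrow> b < 5 \<longrightarrow>
        x (25 * int j + (5 * int a + int b)) = T A u H j a b"
      "\<forall>j<r. \<forall>a b. a \<le> b \<longrightarrow> b < 5 \<longrightarrow>
        y (25 * int j + (5 * int a + int b)) = T A' u' H' j a b"
      using xy unfolding U_def mem_Collect_eq by (elim exE) (rule that)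
    show ?thesis by (rule UI) (use * in \<open>simp add: T_add\<close>)
  qed
  have scale: "(\<lambda>i. c * x i) \<in> U" if x: "x \<in> U" for c x
  proof -
    obtain A u H where *: "\<forall>j<r. \<forall>a b. a \<le> b \<longrightarrow> b < 5 \<longrightarrow>
        x (25 * int j + (5 * int a + int b)) = T A u H j a b"
      using x unfolding U_def mem_Collect_eq by (elim exE) (rule that)
    show ?thesis by (rule UI) (use * in \<open>simp add: T_scale\<close>)
  qed
  have rows: "(\<lambda>i. of_int (row_val xs i)) \<in> U" if xs: "xs \<in> set ?R" for xs
  proof -
    from xs show ?thesis
    proof (cases rule: tangent_rows_cases)
      case (H j l)
      show ?thesis
        by (rule UI[of _ "\<lambda>_ _. 0" "\<lambda>_ _. 0" "\<lambda>i m. if i = j \<and> m = l then 1 else 0"])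
          (use H in \<open>auto simp: r_def[symmetric] row_val_block T_def V_def if_distrib[of "\<lambda>x. x * _"] cong: if_cong\<close>)
    next
      case (u j k)
      show ?thesis
        by (rule UI[of _ "\<lambda>_ _. 0" "\<lambda>i a. if i = j \<and> a = k then 1 else 0" "\<lambda>_ _. 0"])
          (use u in \<open>auto simp: row_val_block T_def V_def\<close>)
    next
      case (A s t)
      show ?thesis
      proof (rule UI[of _ "\<lambda>a b. if a = s \<and> b = t then 1 else 0" "\<lambda>_ _. 0" "\<lambda>_ _. 0"])
        fix j a b :: nat assume *: "j < r" "a \<le> b" "b < 5"
        have row: "row_val xs (25 * int j + (5 * int a + int b)) = (if a = s \<and> b = s then vs ! j ! t else 0)
            - (if a = s \<and> b = t then vs ! j ! b else 0) - (if b = s \<and> a = t then vs ! j ! a else 0)"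
          unfolding A(3) r_def[symmetric] row_val_concat map_map o_def row_val_block[OF *(2,3)] by (rule sum_list_upt_delta[OF *(1)])
        have "(\<Sum>k<5. (if a = s \<and> k = t then 1 else 0) * V j k)
            = (\<Sum>k<5. if k = t then if a = s then V j t else 0 else 0)"
          by (rule sum.cong) auto
        also have "\<dots> = (if a = s then V j t else 0)" using A(2) by simp
        finally have sum: "(\<Sum>k<5. (if a = s \<and> k = t then 1 else 0) * V j k) = (if a = s then V j t else 0)" .
        show "of_int (row_val xs (25 * int j + (5 * int a + int b)))
            = T (\<lambda>a b. if a = s \<and> b = t then 1 else 0) (\<lambda>_ _. 0) (\<lambda>_ _. 0) j a b"
          unfolding row T_def sum by (simp add: V_def)
      qed
    qed
  qed
  have "fst ` set xs \<subseteq> Keys" if xs: "xs \<in> set ?R" for xs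
  proof -
    have block: "fst ` set (block j f) \<subseteq> Keys" if "j < r" for j f
      by (rule subset_trans[OF block_keys]) (use that in \<open>auto simp: Keys_def\<close>)
    have concat: "fst ` set (concat (map (\<lambda>j. block j (f j)) [0..<r])) \<subseteq> Keys" for f
      using block by (simp add: image_UN UN_subset_iff)
    from xs show ?thesis
      by (cases rule: tangent_rows_cases) (simp_all only: r_def[symmetric] block concat)
  qed
  note keys = this
  have Keys: "Keys \<subseteq> set (eliminate ?R)"
    using span unfolding spanning_def Let_def Keys_def r_def[symmetric] list_all_iff
    by fastforce
  have "(\<lambda>i. if i = k then 1 else 0) \<in> U" if "k \<in> Keys" for k
  proof (rule eliminate_spans[OF zero add scale])
    show "(\<lambda>i. of_int (row_val xs i)) \<in> U" if "xs \<in> set ?R" for xs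
      using that by (rule rows)
    show "i \<in> set (eliminate ?R)" if "xs \<in> set ?R" "row_val xs i \<noteq> 0" for xs i
      using row_val_nonzero_key[OF that(2)] keys[OF that(1)] Keys by blast
    show "k \<in> set (eliminate ?R)" using that Keys by blast
  qed
  note units = this
  have span_U: "(\<lambda>i. \<Sum>k\<in>Keys. y k * (if i = k then 1 else 0)) \<in> U" for y
    by (rule closed_linear_combination[OF zero add scale]) (simp_all add: units)
  have "finite Keys" by (simp add: Keys_def)
  \<comment> \<open>The certificate uses the indices 0 to 4, the statement an arbitrary type with
    five elements.\<close>
  obtain idx :: "'n \<Rightarrow> nat" where idx: "bij_betw idx UNIV {..<5}"
    using ex_bij_betw_finite_nat[of "UNIV :: 'n set"] by (auto simp: card atLeast0LessThan)
  define e where "e = the_inv_into UNIV idx"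
  have e: "e (idx x) = x" for x
    unfolding e_def using idx by (intro the_inv_into_f_f) (auto simp: bij_betw_def)
  have idx5: "idx x < 5" for x using idx by (auto simp: bij_betw_def)
  have inj: "idx x = idx y \<longleftrightarrow> x = y" for x y by (metis e)
  have "infinitesimally_surjective r (\<lambda>j x. V j (idx x))"
    unfolding infinitesimally_surjective_def
  proof (intro allI impI)
    fix z :: "nat \<Rightarrow> 'n \<Rightarrow> 'n \<Rightarrow> 'k" assume sym: "\<forall>j a b. z j a b = z j b a"
    \<comment> \<open>Decodes a key into block, row and column; its values matter on
      \<open>Keys\<close> only.\<close>
    define y where "y k = z (nat (k div 25)) (e (nat (k mod 25 div 5))) (e (nat (k mod 25 mod 5)))" for k
    have quot: "(25 * int n + x) div 25 = int n" and rem: "(25 * int n + x) mod 25 = x"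
      if "0 \<le> x" "x < 25" for n x
      using that by (simp_all add: div_pos_pos_trivial mod_pos_pos_trivial)
    have y: "y (25 * int j + (5 * int a + int b)) = z j (e a) (e b)" if "a \<le> b" "b < 5" for j a b
    proof -
      have x: "0 \<le> 5 * int a + int b" "5 * int a + int b < 25" using that by simp_all
      have "(25 * int j + (5 * int a + int b)) div 25 = int j"
        using x by (rule quot)
      moreover have "(25 * int j + (5 * int a + int b)) mod 25 = 5 * int a + int b"
        using x by (rule rem)
      moreover have "(5 * int a + int b) div 5 = int a" "(5 * int a + int b) mod 5 = int b"
        using that by (simp_all add: div_pos_pos_trivial mod_pos_pos_trivial)
      ultimately show ?thesis by (simp add: y_def)
    qed
    have "(\<lambda>i. \<Sum>k\<in>Keys. y k * (if i = k then 1 else 0)) \<in> U"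
      by (rule span_U)
    then obtain A u H where *: "\<forall>j<r. \<forall>a b. a \<le> b \<longrightarrow> b < 5 \<longrightarrow>
        (\<Sum>k\<in>Keys. y k * (if 25 * int j + (5 * int a + int b) = k then 1 else 0)) = T A u H j a b"
      unfolding U_def mem_Collect_eq by (elim exE) (rule that)
    have yT: "z j (e a) (e b) = T A u H j a b" if "j < r" "a \<le> b" "b < 5" for j a b
    proof -
      have "25 * int j + (5 * int a + int b) \<in> Keys"
        using that set_quad_pairs[of a b "5 * int a + int b"] by (force simp: Keys_def)
      then show ?thesis
        using *[rule_format, OF that] that \<open>finite Keys\<close>
        by (simp add: y if_distrib[of "\<lambda>x. _ * x"] cong: if_cong)
    qed
    \<comment> \<open>Keys exist for \<open>a \<le> b\<close> only; symmetry of \<open>T\<close> and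
      of \<open>z\<close> gives the remaining entries.\<close>
    have T_sym: "T A u H j a b = T A u H j b a" for j a b
      by (auto simp: T_def algebra_simps intro!: sum.cong)
    have T: "z j a b = T A u H j (idx a) (idx b)" if "j < r" for j a b
      using yT[OF that, of "idx a" "idx b"] yT[OF that, of "idx b" "idx a"] sym T_sym[of j "idx a" "idx b"] idx5
      by (metis e nle_le)
    have "(\<Sum>k\<in>UNIV. A (idx a) (idx k) * V j (idx k)) = (\<Sum>k<5. A (idx a) k * V j k)" for j a
      by (rule sum.reindex_bij_betw[OF idx])
    then show "\<exists>A u H. \<forall>j<r. \<forall>a b. z j a b =
        u j a * V j (idx b) + V j (idx a) * u j b - (if a = b then u j a else 0)
        + ((if a = b then \<Sum>k\<in>UNIV. A a k * V j (idx k) else 0) - V j (idx b) * A a b - V j (idx a) * A b a)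
        + (\<Sum>l<r. H j l * (V l (idx a) * V l (idx b) - (if a = b then V l (idx a) else 0)))"
      by (intro exI[of _ "\<lambda>a b. A (idx a) (idx b)"] exI[of _ "\<lambda>j a. u j (idx a)"] exI[of _ H])
        (simp add: T T_def inj)
  qed
  then show ?thesis unfolding r_def by blast
qed


text \<open>There are 91 rows for 90 keys, and scaling forces one relation, namely
  \<open>A = 1\<close>, \<open>u = v\<close>, \<open>H = -2\<close>. So these vectors attain the
  largest rank that any choice could have. An entry -1 contributes the diagonal value
  \<open>(-1)^2 - (-1) = 2\<close>, which 0/1 vectors cannot.\<close>

lemma spanning_6: "spanning
    [[0, 1, 1, 0, 0], [0, 1, 0, -1, 0], [1, 0, 1, 0, 0], [1, 0, 1, 0, 1], [0, 1, 0, -1, 1],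
     [1, 0, 0, -1, 1]]"
  by code_simp

lemma spanning_7: "spanning
    [[-1, 1, 0, 0, 0], [0, 1, 0, 0, 1], [0, 0, 1, 1, 0], [0, 1, 0, 1, 0], [1, 0, 1, 0, 0],
     [0, 1, 1, 0, -1], [1, 0, 0, 1, -1]]"
  by code_simp

text \<open>The first five vectors are the edges of a 5-cycle. All entries are 0 or 1, so every
  \<open>v v^T - diag v\<close> has zero diagonal, and the diagonal directions come from
  \<open>u\<close> and \<open>A\<close>.\<close>

lemma spanning_8: "spanning
    [[1, 1, 0, 0, 0], [0, 1, 1, 0, 0], [1, 0, 0, 1, 0], [0, 0, 0, 1, 1], [0, 0, 1, 0, 1],
     [1, 0, 1, 1, 0], [0, 1, 0, 1, 1], [1, 1, 1, 0, 1]]"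
  by code_simp

text \<open>Seven edges and two triples. The nine quadrics \<open>v v^T - diag v\<close> lie in the
  10-dimensional space of quadrics with zero diagonal and cannot fill it; \<open>u\<close> and
  \<open>A\<close> supply the missing direction as well as the diagonal.\<close>

lemma spanning_9: "spanning
    [[0, 1, 0, 0, 1], [1, 0, 0, 0, 1], [0, 0, 0, 1, 1], [0, 0, 1, 0, 1], [1, 1, 0, 0, 0],
     [0, 1, 1, 0, 0], [1, 0, 0, 1, 0], [0, 1, 1, 1, 0], [1, 0, 1, 1, 0]]"
  by code_simp

theorem theorem1p1:
  fixes r :: nat
  assumes "6 \<le> r" and "r \<le> 15"
  shows "(translated_one_step_locus r :: (5, 'k::{alg_closed_field, field_char_0}) mpoly set set)
           \<subseteq> smoothable_component (6 + r)"
proof -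
  have "\<exists>v :: nat \<Rightarrow> 5 \<Rightarrow> 'k. infinitesimally_surjective r v"
  proof (cases "10 \<le> r")
    case True
    \<comment> \<open>The threshold 10 is the number of pairs of coordinates.\<close>
    have "CARD(5) choose 2 \<le> r" using True by (simp add: choose_two)
    then show ?thesis by (rule infinitesimally_surjective_edges)
  next
    case False
    with assms consider "r = 6" | "r = 7" | "r = 8" | "r = 9" by linarith
    then obtain vs where "spanning vs" "length vs = r"
    proof cases
      case 1
      then show thesis using that[OF spanning_6] by simp
    next
      case 2
      then show thesis using that[OF spanning_7] by simp
    next
      case 3
      then show thesis using that[OF spanning_8] by simp
    next
      case 4
      then show thesis using that[OF spanning_9] by simp
    qed
    then show ?thesis using spanning_imp_infinitesimally_surjective[of vs, where 'n = 5] by auto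
  qed
  then obtain v :: "nat \<Rightarrow> 5 \<Rightarrow> 'k" where "infinitesimally_surjective r v" by blast
  from translated_one_step_locus_smoothable[OF this] show ?thesis by simp
qed

end
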